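(* Let $\mathbf{w}$ be a weight vector with $n=|\mathbf{w}|$ even, let $I_n=\ker\phi$ and $I_{\mathbf{w}}=\ker\psi$ be the ideals of relations among the generators of the rings of invariants $R_n$ (for the weight $1^n$) and $R_{\mathbf{w}}$ (for the weight $\mathbf{w}$), and let $\alpha:I_n\to I_{\mathbf{w}}$ be the map induced by the vertex-identification map $\beta$. Then the map $\alpha:I_n\to I_{\mathbf{w}}$ is surjective.
   Context: A weight vector is a tuple $\mathbf{w}=(w_1,\dots,w_k)$ of positive integers, and $|\mathbf{w}|=\sum_i w_i$. A graph on the vertices $1,\dots,r$ is a directed graph; multiple edges are allowed, loops are not. Its multidegree (multi-valence) $\mathbf{deg}\,\Gamma$ is the $r$-tuple of valences of its vertices. For an edge $e$, $h(e)$ and $t(e)$ are its head and tail. To a graph $\Gamma$ one associates $$\prod_{e\in\Gamma}\bigl(u_{h(e)}v_{t(e)}-u_{t(e)}v_{h(e)}\bigr)\in\mathbb{Z}[u_1,v_1,\dots,u_r,v_r],$$ the invariant of $\Gamma$. For a weight vector $\mathbf{v}$ of length $r$ with $|\mathbf{v}|$ even, the ring of invariants for $\mathbf{v}$ is the graded ring $\bigoplus_{d\ge 0}A_d$, where $A_d$ is the $\mathbb{Z}$-span of the invariants of graphs of multidegree $d\mathbf{v}$. Write $R_{\mathbf{w}}$ for the ring of invariants for $\mathbf{w}$ and $R_n$ for the ring of invariants for $1^n=(1,\dots,1)$, where $n=|\mathbf{w}|$. These rings are generated in degree $1$. Partition $\{1,\dots,n\}$ into consecutive blocks ("clumps") of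 sizes $w_1,\dots,w_k$; the $i$th clump corresponds to vertex $i$ of $\{1,\dots,k\}$. Consider the commutative diagram with exact rows $$\begin{array}{ccccccccc}0&\to& I_n&\to&\mathbb{Z}[\{X_\Gamma\}]&\xrightarrow{\ \phi\ }&R_n&\to&0\\ &&\downarrow{\scriptstyle\alpha}&&\downarrow{\scriptstyle\beta}&&\downarrow{\scriptstyle\gamma}&&\\ 0&\to& I_{\mathbf{w}}&\to&\mathbb{Z}[\{X_\Omega\}]&\xrightarrow{\ \psi\ }&R_{\mathbf{w}}&\to&0\end{array}$$ Here $\Gamma$ ranges over the (directed) matchings of the $n$ vertices $\{1,\dots,n\}$, i.e. graphs of multidegree $1^n$, and $\Omega$ ranges over the graphs on $\{1,\dots,k\}$ of multidegree $\mathbf{w}$; $\mathbb{Z}[\{X_\Gamma\}]$ and $\mathbb{Z}[\{X_\Omega\}]$ are polynomial rings in formal variables. The ring homomorphisms $\phi$ and $\psi$ send each formal variable to the invariant of the corresponding graph. The ring homomorphism $\beta$ sends $X_\Gamma$ to $X_\Omega$, where $\Omega$ is obtained from $\Gamma$ by identifying the vertices within each clump; if this introduces a loop then $\beta(X_\Gamma)=0$. The map $\gamma$ is the induced map on invariants (setting points in the same clump equal), and $\alpha$ is the restriction of $\beta$ to $I_n$. *)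

theory Defs
  imports Complex_Main "HOL-Library.Multiset" "HOL-Library.Poly_Mapping"
    "HOL-Computational_Algebra.Polynomial"
begin

section \<open>Integer polynomials in an arbitrary set of variables\<close>

text \<open>
  A monomial is a finitely supported exponent function, and a polynomial is a finitely supported
  integer-valued function on monomials; the ring structure is the convolution product.
\<close>

type_synonym 'v int_mpoly = "('v \<Rightarrow>\<^sub>0 nat) \<Rightarrow>\<^sub>0 int"

definition Var :: "'v \<Rightarrow> 'v int_mpoly" where
  "Var x = Poly_Mapping.single (Poly_Mapping.single x 1) 1"

text \<open>The subring of polynomials involving only the variables in \<open>S\<close>.\<close>

definition poly_ring_on :: "'v set \<Rightarrow> 'v int_mpoly set" where
  "poly_ring_on S = {p. \<forall>m \<in> Poly_Mapping.keys p. Poly_Mapping.keys m \<subseteq> S}"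

text \<open>
  The ring homomorphism out of a polynomial ring that sends each variable \<open>x\<close> to \<open>f x\<close>
  (see \<open>poly_hom_Var\<close>, \<open>poly_hom_1\<close>, \<open>poly_hom_add\<close>, \<open>poly_hom_mult\<close> below).
\<close>

definition mono_hom :: "('v \<Rightarrow> 'b::comm_ring_1) \<Rightarrow> ('v \<Rightarrow>\<^sub>0 nat) \<Rightarrow> 'b" where
  "mono_hom f m = (\<Prod>x \<in> Poly_Mapping.keys m. f x ^ Poly_Mapping.lookup m x)"

definition poly_hom :: "('v \<Rightarrow> 'b::comm_ring_1) \<Rightarrow> 'v int_mpoly \<Rightarrow> 'b" where
  "poly_hom f p = (\<Sum>m \<in> Poly_Mapping.keys p. of_int (Poly_Mapping.lookup p m) * mono_hom f m)"

lemma mono_hom_superset: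
  "finite A \<Longrightarrow> Poly_Mapping.keys m \<subseteq> A \<Longrightarrow> mono_hom f m = (\<Prod>x \<in> A. f x ^ Poly_Mapping.lookup m x)"
  unfolding mono_hom_def by (rule prod.mono_neutral_left) (auto simp: in_keys_iff)

lemma mono_hom_0 [simp]: "mono_hom f 0 = 1"
  by (simp add: mono_hom_def)

lemma mono_hom_single [simp]: "mono_hom f (Poly_Mapping.single x n) = f x ^ n"
  by (cases "n = 0") (simp_all add: mono_hom_def)

lemma mono_hom_add: "mono_hom f (m + m') = mono_hom f m * mono_hom f m'"
proof -
  let ?A = "Poly_Mapping.keys m \<union> Poly_Mapping.keys m'"
  have "mono_hom f (m + m') = (\<Prod>x \<in> ?A. f x ^ Poly_Mapping.lookup (m + m') x)"
    by (rule mono_hom_superset) (auto dest: subsetD[OF keys_add])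
  also have "\<dots> = (\<Prod>x \<in> ?A. f x ^ Poly_Mapping.lookup m x) * (\<Prod>x \<in> ?A. f x ^ Poly_Mapping.lookup m' x)"
    by (simp add: lookup_add power_add prod.distrib)
  also have "\<dots> = mono_hom f m * mono_hom f m'"
    by (simp add: mono_hom_superset[where A = ?A])
  finally show ?thesis .
qed

lemma poly_hom_superset:
  "finite A \<Longrightarrow> Poly_Mapping.keys p \<subseteq> A \<Longrightarrow> poly_hom f p = (\<Sum>m \<in> A. of_int (Poly_Mapping.lookup p m) * mono_hom f m)"
  unfolding poly_hom_def by (rule sum.mono_neutral_left) (auto simp: in_keys_iff)

lemma poly_hom_0 [simp]: "poly_hom f 0 = 0"
  by (simp add: poly_hom_def)

lemma poly_hom_single [simp]:
  "poly_hom f (Poly_Mapping.single m c) = of_int c * mono_hom f m"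
  by (cases "c = 0") (simp_all add: poly_hom_def)

lemma poly_hom_1 [simp]: "poly_hom f 1 = 1"
  using poly_hom_single[of f 0 1] by simp

lemma poly_hom_Var [simp]: "poly_hom f (Var x) = f x"
  by (simp add: Var_def)

lemma poly_hom_add: "poly_hom f (p + q) = poly_hom f p + poly_hom f q"
proof -
  let ?A = "Poly_Mapping.keys p \<union> Poly_Mapping.keys q"
  have "poly_hom f (p + q) = (\<Sum>m \<in> ?A. of_int (Poly_Mapping.lookup (p + q) m) * mono_hom f m)"
    by (rule poly_hom_superset) (auto dest: subsetD[OF keys_add])
  also have "\<dots> = (\<Sum>m \<in> ?A. of_int (Poly_Mapping.lookup p m) * mono_hom f m)
      + (\<Sum>m \<in> ?A. of_int (Poly_Mapping.lookup q m) * mono_hom f m)"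
    by (simp add: lookup_add ring_distribs sum.distrib)
  also have "\<dots> = poly_hom f p + poly_hom f q"
    by (simp add: poly_hom_superset[where A = ?A])
  finally show ?thesis .
qed

lemma int_mpoly_induct [case_names zero add]:
  fixes p :: "'v int_mpoly"
  assumes "P 0"
    and "\<And>p m c. P p \<Longrightarrow> P (Poly_Mapping.single m c + p)"
  shows "P p"
proof (induction p rule: Poly_Mapping.update_induct)
  case const
  show ?case by (rule assms(1))
next
  case (update p m c)
  have "Poly_Mapping.update m c p = Poly_Mapping.single m c + p"
    using update(1) by (intro poly_mapping_eqI) (auto simp: lookup_update lookup_add lookup_single in_keys_iff when_def)
  then show ?case using assms(2) update by simp
qed

lemma poly_hom_mult: "poly_hom f (p * q) = poly_hom f p * poly_hom f q"
proof (induction p rule: int_mpoly_induct)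
  case zero
  show ?case by simp
next
  case (add p m c)
  have "poly_hom f (Poly_Mapping.single m c * q) = poly_hom f (Poly_Mapping.single m c) * poly_hom f q"
  proof (induction q rule: int_mpoly_induct)
    case zero
    show ?case by simp
  next
    case (add q m' c')
    then show ?case
      by (simp add: ring_distribs poly_hom_add mult_single mono_hom_add algebra_simps)
  qed
  with add show ?case by (simp add: ring_distribs poly_hom_add)
qed


section \<open>Graphs and their invariants\<close>

text \<open>
  A directed multigraph is the multiset of its edges, an edge being the pair (tail, head).
  Vertices are numbered from \<open>0\<close>, so the vertex set of a graph on \<open>r\<close> vertices is \<open>{0..<r}\<close>.
\<close>

type_synonym graph = "(nat \<times> nat) multiset"

definition has_loop :: "graph \<Rightarrow> bool" where
  "has_loop G \<longleftrightarrow> (\<exists>e \<in># G. fst e = snd e)"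

definition is_graph :: "nat \<Rightarrow> graph \<Rightarrow> bool" where
  "is_graph r G \<longleftrightarrow> (\<forall>e \<in># G. fst e < r \<and> snd e < r) \<and> \<not> has_loop G"

definition valence :: "graph \<Rightarrow> nat \<Rightarrow> nat" where
  "valence G i = size (filter_mset (\<lambda>e. fst e = i \<or> snd e = i) G)"

definition multidegree :: "nat \<Rightarrow> graph \<Rightarrow> nat list" where
  "multidegree r G = map (valence G) [0..<r]"

definition graphs_of_multidegree :: "nat list \<Rightarrow> graph set" where
  "graphs_of_multidegree v = {G. is_graph (length v) G \<and> multidegree (length v) G = v}"

datatype coord = U nat | V nat

definition graph_invariant :: "graph \<Rightarrow> coord int_mpoly" where
  "graph_invariant G =
     (\<Prod>(t, h) \<in># G. Var (U h) * Var (V t) - Var (U t) * Var (V h))"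


section \<open>Rings of invariants and ideals of relations\<close>

definition weight_vector :: "nat list \<Rightarrow> bool" where
  "weight_vector w \<longleftrightarrow> (\<forall>x \<in> set w. 0 < x)"

definition scale_weight :: "nat \<Rightarrow> nat list \<Rightarrow> nat list" where
  "scale_weight d w = map (\<lambda>x. d * x) w"

definition invariants_of_degree :: "nat list \<Rightarrow> nat \<Rightarrow> coord int_mpoly set" where
  "invariants_of_degree w d =
     module.span (\<lambda>(c::int) p. of_int c * p)
       (graph_invariant ` graphs_of_multidegree (scale_weight d w))"

text \<open>
  The graded ring, direct sum of the \<open>invariants_of_degree w d\<close>, is realised inside the
  univariate polynomials over the coordinate ring: the coefficient of degree \<open>d\<close> is the homogeneous
  component of degree \<open>d\<close>.
\<close>

definition invariant_ring :: "nat list \<Rightarrow> coord int_mpoly poly set" where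
  "invariant_ring w = {p. \<forall>d. coeff p d \<in> invariants_of_degree w d}"

text \<open>The map \<open>\<psi>\<close>, and also \<open>\<phi>\<close> (for \<open>w = replicate n 1\<close>).\<close>

definition generator_hom :: "graph int_mpoly \<Rightarrow> coord int_mpoly poly" where
  "generator_hom = poly_hom (\<lambda>G. monom (graph_invariant G) 1)"

definition relation_ideal :: "nat list \<Rightarrow> graph int_mpoly set" where
  "relation_ideal w =
     {p \<in> poly_ring_on (graphs_of_multidegree w). generator_hom p = 0}"

lemma int_module: "module (\<lambda>(c::int) (p::'a::comm_ring_1). of_int c * p)"
  by unfold_locales (simp_all add: algebra_simps)

lemma valence_add: "valence (G + H) i = valence G i + valence H i"
  by (simp add: valence_def)

lemma graph_invariant_add: "graph_invariant (G + H) = graph_invariant G * graph_invariant H"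
  by (simp add: graph_invariant_def)

lemma graphs_of_multidegree_iff:
  "G \<in> graphs_of_multidegree v \<longleftrightarrow>
     is_graph (length v) G \<and> (\<forall>i < length v. valence G i = v ! i)"
  unfolding graphs_of_multidegree_def multidegree_def
  by (subst mem_Collect_eq, subst list_eq_iff_nth_eq) simp

lemma is_graph_add: "is_graph r G \<Longrightarrow> is_graph r H \<Longrightarrow> is_graph r (G + H)"
  unfolding is_graph_def has_loop_def by auto

lemma empty_graph_of_multidegree: "{#} \<in> graphs_of_multidegree (scale_weight 0 w)"
  by (simp add: graphs_of_multidegree_iff is_graph_def has_loop_def scale_weight_def valence_def)

lemma add_graphs_of_multidegree:
  assumes "G \<in> graphs_of_multidegree (scale_weight d w)"
    and "H \<in> graphs_of_multidegree (scale_weight e w)"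
  shows "G + H \<in> graphs_of_multidegree (scale_weight (d + e) w)"
  using assms
  by (simp add: graphs_of_multidegree_iff is_graph_add scale_weight_def valence_add
      add_mult_distrib)

lemma generator_power:
  assumes "G \<in> graphs_of_multidegree w"
  shows "\<exists>H \<in> graphs_of_multidegree (scale_weight n w).
           monom (graph_invariant G) 1 ^ n = monom (graph_invariant H) n"
proof (induction n)
  case 0
  show ?case
    using empty_graph_of_multidegree
    by (intro bexI[of _ "{#}"]) (auto simp: graph_invariant_def)
next
  case (Suc n)
  then obtain H where H: "H \<in> graphs_of_multidegree (scale_weight n w)"
    "monom (graph_invariant G) 1 ^ n = monom (graph_invariant H) n" by blast
  have "G \<in> graphs_of_multidegree (scale_weight 1 w)"
    using assms by (simp add: scale_weight_def)
  from add_graphs_of_multidegree[OF this H(1)] H(2) show ?case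
    by (intro bexI[of _ "G + H"]) (auto simp: graph_invariant_add mult_monom)
qed

lemma generator_hom_in_invariant_ring:
  assumes "p \<in> poly_ring_on (graphs_of_multidegree w)"
  shows "generator_hom p \<in> invariant_ring w"
proof -
  interpret Z: module "\<lambda>(c::int) (p::coord int_mpoly). of_int c * p" by (rule int_module)
  let ?g = "\<lambda>G. monom (graph_invariant G) 1"
  have prod: "\<exists>d. \<exists>H \<in> graphs_of_multidegree (scale_weight d w).
        (\<Prod>x \<in> A. ?g x ^ Poly_Mapping.lookup m x) = monom (graph_invariant H) d"
    if "finite A" "A \<subseteq> graphs_of_multidegree w" for A m
    using that
  proof (induction A rule: finite_induct)
    case empty
    show ?case
      using empty_graph_of_multidegree
      by (intro exI[of _ 0] bexI[of _ "{#}"]) (auto simp: graph_invariant_def)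
  next
    case (insert x A)
    then obtain d H where H: "H \<in> graphs_of_multidegree (scale_weight d w)"
      "(\<Prod>x \<in> A. ?g x ^ Poly_Mapping.lookup m x) = monom (graph_invariant H) d" by auto
    obtain K where K: "K \<in> graphs_of_multidegree (scale_weight (Poly_Mapping.lookup m x) w)"
      "?g x ^ Poly_Mapping.lookup m x = monom (graph_invariant K) (Poly_Mapping.lookup m x)"
      using generator_power insert.prems by blast
    show ?case
      using add_graphs_of_multidegree[OF K(1) H(1)] insert.hyps H(2) K(2)
      by (intro exI[of _ "Poly_Mapping.lookup m x + d"] bexI[of _ "K + H"])
        (auto simp: graph_invariant_add mult_monom)
  qed
  have "coeff (of_int c * mono_hom ?g m) d \<in> invariants_of_degree w d"
    if m: "Poly_Mapping.keys m \<subseteq> graphs_of_multidegree w" for m c d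
  proof -
    obtain e H where H: "H \<in> graphs_of_multidegree (scale_weight e w)"
      "mono_hom ?g m = monom (graph_invariant H) e"
      using prod[OF finite_keys m] unfolding mono_hom_def by blast
    have "coeff (of_int c * mono_hom ?g m) d = of_int c * (if e = d then graph_invariant H else 0)"
      unfolding H(2) by (simp add: of_int_poly coeff_monom)
    also have "\<dots> \<in> invariants_of_degree w d"
      unfolding invariants_of_degree_def
      using H(1) by (intro Z.span_scale) (auto intro: Z.span_base Z.span_zero)
    finally show ?thesis .
  qed
  then show ?thesis
    using assms
    unfolding generator_hom_def poly_hom_def invariant_ring_def poly_ring_on_def
    by (auto simp: coeff_sum invariants_of_degree_def intro!: Z.span_sum)
qed


section \<open>Identification of vertices within clumps\<close>

definition clump :: "nat list \<Rightarrow> nat \<Rightarrow> nat set" where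
  "clump w i = {sum_list (take i w) ..< sum_list (take (Suc i) w)}"

definition clump_index :: "nat list \<Rightarrow> nat \<Rightarrow> nat" where
  "clump_index w j = (THE i. i < length w \<and> j \<in> clump w i)"

definition identify_vertices :: "nat list \<Rightarrow> graph \<Rightarrow> graph" where
  "identify_vertices w G = image_mset (map_prod (clump_index w) (clump_index w)) G"

text \<open>The map \<open>\<beta>\<close>.\<close>

definition identify_hom :: "nat list \<Rightarrow> graph int_mpoly \<Rightarrow> graph int_mpoly" where
  "identify_hom w = poly_hom (\<lambda>G.
     if has_loop (identify_vertices w G) then 0 else Var (identify_vertices w G))"

lemma sum_list_take_mono: "i \<le> j \<Longrightarrow> sum_list (take i w) \<le> sum_list (take j (w::nat list))"
proof -
  assume "i \<le> j"
  then have "take j w = take i w @ take (j - i) (drop i w)"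
    using take_add[of i "j - i" w] by simp
  then show ?thesis by simp
qed

lemma clump_ex1:
  assumes "j < sum_list w"
  shows "\<exists>!i. i < length w \<and> j \<in> clump w i"
proof -
  have ex: "\<exists>i. i < length w \<and> j \<in> clump w i"
  proof -
    let ?i = "LEAST i. j < sum_list (take (Suc i) w)"
    have "w \<noteq> []" using assms by auto
    then have ex: "j < sum_list (take (Suc (length w - 1)) w)" using assms by simp
    have 1: "j < sum_list (take (Suc ?i) w)" by (rule LeastI[of _ "length w - 1"]) (rule ex)
    have "?i \<le> length w - 1" by (rule Least_le) (rule ex)
    then have 2: "?i < length w" using \<open>w \<noteq> []\<close> by (cases w) auto
    have "sum_list (take ?i w) \<le> j"
    proof (cases ?i)
      case (Suc l)
      then have "\<not> j < sum_list (take (Suc l) w)"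
        using not_less_Least[of l "\<lambda>i. j < sum_list (take (Suc i) w)"] by simp
      with Suc show ?thesis by simp
    qed simp
    with 1 2 show ?thesis by (auto simp: clump_def)
  qed
  have False if "i < i'" "j \<in> clump w i" "j \<in> clump w i'" for i i'
    using that sum_list_take_mono[of "Suc i" i' w] by (auto simp: clump_def)
  then have "i = i'" if "j \<in> clump w i" "j \<in> clump w i'" for i i'
    using that by (cases i i' rule: linorder_cases) blast+
  with ex show ?thesis by blast
qed

lemma clump_index:
  assumes "j < sum_list w"
  shows "clump_index w j < length w" and "j \<in> clump w (clump_index w j)"
  using theI'[OF clump_ex1[OF assms]] by (auto simp: clump_index_def)

end

theory Submission
  imports Defs
begin

text \<open>
  A diagram chase reduces the theorem to showing that the kernel of \<open>\<gamma>\<close> is the image of the kernel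
  of \<open>\<beta>\<close> under \<open>\<phi>\<close>. In degree \<open>d\<close>, the kernel of \<open>\<gamma>\<close> is spanned by the invariants of graphs
  with an edge inside a clump: modulo these, the invariant of a graph depends only on the graph
  obtained by identifying vertices, and can be straightened to a combination of lifts of
  non-nesting graphs on the clumps, whose invariants are linearly independent because they have
  distinct leading terms. Finally, let \<open>e\<close> be an edge of a \<open>d\<close>-regular graph that lies inside a clump.
  Colour half of the vertices so that \<open>e\<close> is bichromatic. Pluecker relations that leave \<open>e\<close> alone make
  the graph bipartite, and Hall's theorem splits a regular bipartite graph into perfect matchings.
  The one containing \<open>e\<close> is killed by \<open>\<beta>\<close>.
\<close>

section \<open>Homomorphisms of polynomial rings\<close>

lemma poly_hom_uminus: "poly_hom f (- p) = - poly_hom f p"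
  using poly_hom_add[of f p "- p"] by (simp add: eq_neg_iff_add_eq_0 add.commute)

lemma poly_hom_diff: "poly_hom f (p - q) = poly_hom f p - poly_hom f q"
  using poly_hom_add[of f p "- q"] by (simp add: poly_hom_uminus)

lemma poly_hom_sum: "poly_hom f (sum g A) = (\<Sum>x\<in>A. poly_hom f (g x))"
  by (induction A rule: infinite_finite_induct) (simp_all add: poly_hom_add)

lemma poly_hom_prod: "poly_hom f (prod g A) = (\<Prod>x\<in>A. poly_hom f (g x))"
  by (induction A rule: infinite_finite_induct) (simp_all add: poly_hom_mult)

lemma poly_hom_prod_mset:
  "poly_hom f (\<Prod>x\<in>#M. g x) = (\<Prod>x\<in>#M. poly_hom f (g x))"
  by (induction M) (simp_all add: poly_hom_mult)

lemma poly_hom_prod_list: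
  "poly_hom f (\<Prod>x\<leftarrow>xs. g x) = (\<Prod>x\<leftarrow>xs. poly_hom f (g x))"
  by (induction xs) (simp_all add: poly_hom_mult)

lemma poly_hom_power: "poly_hom f (p ^ k) = poly_hom f p ^ k"
  by (induction k) (simp_all add: poly_hom_mult)

lemma poly_hom_of_int: "poly_hom f (of_int c) = of_int c"
  using poly_hom_single[of f 0 "of_int c"] by (simp only: single_of_int) simp

lemma poly_hom_mono_hom: "poly_hom g (mono_hom f m) = mono_hom (\<lambda>x. poly_hom g (f x)) m"
  by (simp add: mono_hom_def poly_hom_prod poly_hom_power)

lemma poly_hom_compose: "poly_hom g (poly_hom f p) = poly_hom (\<lambda>x. poly_hom g (f x)) p"
  unfolding poly_hom_def[of f] poly_hom_def[of "\<lambda>x. poly_hom g (f x)"]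
  by (simp add: poly_hom_sum poly_hom_mult poly_hom_of_int poly_hom_mono_hom)

lemma poly_hom_cong:
  assumes "p \<in> poly_ring_on S" and "\<And>x. x \<in> S \<Longrightarrow> f x = g x"
  shows "poly_hom f p = poly_hom g p"
proof -
  have "mono_hom f m = mono_hom g m" if "m \<in> Poly_Mapping.keys p" for m
    unfolding mono_hom_def using assms that
    by (intro prod.cong refl arg_cong2[where f = "(^)"]) (auto simp: poly_ring_on_def)
  then show ?thesis by (simp add: poly_hom_def)
qed

lemma mono_hom_Var: "mono_hom Var m = Poly_Mapping.single m 1"
proof (induction m rule: Poly_Mapping.update_induct)
  case const
  show ?case by simp
next
  case (update m x k)
  have pow: "Var x ^ k = Poly_Mapping.single (Poly_Mapping.single x k) 1" for k
    by (induction k) (simp_all add: Var_def mult_single flip: Poly_Mapping.single_add)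
  have "Poly_Mapping.update x k m = Poly_Mapping.single x k + m"
    using update(1)
    by (intro poly_mapping_eqI) (auto simp: lookup_update lookup_add lookup_single in_keys_iff when_def)
  then show ?case using update by (simp add: mono_hom_add pow mult_single)
qed

lemma poly_hom_Var_id: "poly_hom Var p = p"
proof (induction p rule: int_mpoly_induct)
  case (add p m c)
  have "of_int c * Poly_Mapping.single m 1 = Poly_Mapping.single m c"
    by (simp flip: single_of_int add: mult_single)
  with add show ?case by (simp add: poly_hom_add mono_hom_Var)
qed simp

section \<open>Closure of the polynomial ring on a given set of variables\<close>

lemma poly_ring_on_0: "0 \<in> poly_ring_on S"
  by (simp add: poly_ring_on_def)

lemma poly_ring_on_of_int: "of_int c \<in> poly_ring_on S"
  by (simp add: poly_ring_on_def flip: single_of_int)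

lemma poly_ring_on_1: "1 \<in> poly_ring_on S"
  using poly_ring_on_of_int[of 1] by simp

lemma poly_ring_on_Var: "x \<in> S \<Longrightarrow> Var x \<in> poly_ring_on S"
  by (simp add: poly_ring_on_def Var_def)

lemma poly_ring_on_add:
  "p \<in> poly_ring_on S \<Longrightarrow> q \<in> poly_ring_on S \<Longrightarrow> p + q \<in> poly_ring_on S"
  using keys_add[of p q] unfolding poly_ring_on_def by blast

lemma poly_ring_on_diff:
  "p \<in> poly_ring_on S \<Longrightarrow> q \<in> poly_ring_on S \<Longrightarrow> p - q \<in> poly_ring_on S"
  using keys_diff[of p q] unfolding poly_ring_on_def by blast

lemma poly_ring_on_mult:
  assumes "p \<in> poly_ring_on S" and "q \<in> poly_ring_on S"
  shows "p * q \<in> poly_ring_on S"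
  unfolding poly_ring_on_def
proof (intro CollectI ballI)
  fix m assume "m \<in> Poly_Mapping.keys (p * q)"
  then obtain a b where "m = a + b" "a \<in> Poly_Mapping.keys p" "b \<in> Poly_Mapping.keys q"
    using keys_mult[of p q] by blast
  then show "Poly_Mapping.keys m \<subseteq> S"
    using assms keys_add[of a b] unfolding poly_ring_on_def by blast
qed

lemma poly_ring_on_sum:
  "(\<And>x. x \<in> A \<Longrightarrow> f x \<in> poly_ring_on S) \<Longrightarrow> sum f A \<in> poly_ring_on S"
  by (induction A rule: infinite_finite_induct) (simp_all add: poly_ring_on_0 poly_ring_on_add)

lemma poly_ring_on_prod:
  "(\<And>x. x \<in> A \<Longrightarrow> f x \<in> poly_ring_on S) \<Longrightarrow> prod f A \<in> poly_ring_on S"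
  by (induction A rule: infinite_finite_induct) (simp_all add: poly_ring_on_1 poly_ring_on_mult)

lemma poly_ring_on_power: "p \<in> poly_ring_on S \<Longrightarrow> p ^ k \<in> poly_ring_on S"
  by (induction k) (simp_all add: poly_ring_on_1 poly_ring_on_mult)

lemma poly_ring_on_prod_list:
  "(\<And>x. x \<in> set xs \<Longrightarrow> f x \<in> poly_ring_on S) \<Longrightarrow> (\<Prod>x\<leftarrow>xs. f x) \<in> poly_ring_on S"
  by (induction xs) (simp_all add: poly_ring_on_1 poly_ring_on_mult)

lemma poly_hom_in_poly_ring_on:
  assumes "p \<in> poly_ring_on S" and "\<And>x. x \<in> S \<Longrightarrow> f x \<in> poly_ring_on T"
  shows "poly_hom f p \<in> poly_ring_on T"
proof -
  have "f x \<in> poly_ring_on T" if "m \<in> Poly_Mapping.keys p" "x \<in> Poly_Mapping.keys m" for m x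
    using assms that by (auto simp: poly_ring_on_def[of S])
  then show ?thesis
    unfolding poly_hom_def mono_hom_def
    by (intro poly_ring_on_sum poly_ring_on_mult poly_ring_on_of_int poly_ring_on_prod
        poly_ring_on_power)
qed

lemma mono_hom_monom:
  "mono_hom (\<lambda>x. monom (a x) 1) m = monom (mono_hom a m) (\<Sum>x \<in> Poly_Mapping.keys m. Poly_Mapping.lookup m x)"
proof -
  have "(\<Prod>x \<in> A. monom (a x) 1 ^ k x) = monom (\<Prod>x \<in> A. a x ^ k x) (\<Sum>x \<in> A. k x)"
    if "finite A" for A and k :: "_ \<Rightarrow> nat"
    using that by induction (simp_all add: monom_power mult_monom)
  then show ?thesis by (simp add: mono_hom_def)
qed

lemma coeff_of_int_mult: "coeff (of_int c * p) d = of_int c * coeff p d"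
  by (simp add: of_int_poly)

text \<open>Every generator goes to degree 1 in the auxiliary variable, so each monomial lands in a
  single degree and a homomorphism applied to the coefficients respects the grading. This allows
  \<gamma> to be treated one degree at a time.\<close>

lemma poly_hom_coeff:
  "coeff (poly_hom (\<lambda>x. monom (poly_hom g (a x)) 1) p) d
    = poly_hom g (coeff (poly_hom (\<lambda>x. monom (a x) 1) p) d)"
proof (induction p rule: int_mpoly_induct)
  case zero
  show ?case by simp
next
  case (add p m c)
  have *: "coeff (of_int c * mono_hom (\<lambda>x. monom (poly_hom g (a x)) 1) m) d
      = poly_hom g (coeff (of_int c * mono_hom (\<lambda>x. monom (a x) 1) m) d)"
    unfolding mono_hom_monom coeff_of_int_mult
    by (simp add: poly_hom_mult poly_hom_of_int poly_hom_mono_hom coeff_monom)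
  show ?case
    using add by (simp only: poly_hom_add poly_hom_single coeff_add *)
qed

section \<open>Endpoints and brackets\<close>

text \<open>For loopless graphs this records all valences at once. A loop counts twice, unlike in
  \<open>valence\<close>, so the multiset is unchanged when edges exchange endpoints.\<close>

definition endpoints :: "graph \<Rightarrow> nat multiset" where
  "endpoints G = image_mset fst G + image_mset snd G"

definition bracket :: "nat \<Rightarrow> nat \<Rightarrow> coord int_mpoly" where
  "bracket t h = Var (U h) * Var (V t) - Var (U t) * Var (V h)"

text \<open>The map \<open>c\<close> is arbitrary so that the kernel of the identification can be
  computed for any fibres; \<open>clump_index w\<close> is substituted at the end.\<close>

definition identify :: "(nat \<Rightarrow> nat) \<Rightarrow> graph \<Rightarrow> graph" where
  "identify c G = image_mset (map_prod c c) G"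

lemma endpoints_simps [simp]:
  "endpoints {#} = {#}"
  "endpoints (add_mset e G) = add_mset (fst e) (add_mset (snd e) (endpoints G))"
  "endpoints (G + H) = endpoints G + endpoints H"
  by (simp_all add: endpoints_def)

lemma identify_simps [simp]:
  "identify c {#} = {#}"
  "identify c (add_mset e G) = add_mset (c (fst e), c (snd e)) (identify c G)"
  by (simp_all add: identify_def map_prod_def case_prod_beta)

lemma endpoints_identify: "endpoints (identify c G) = image_mset c (endpoints G)"
  by (induction G) simp_all

lemma has_loop_simps [simp]:
  "\<not> has_loop {#}"
  "has_loop (add_mset e G) \<longleftrightarrow> fst e = snd e \<or> has_loop G"
  by (auto simp: has_loop_def)

lemma has_loop_identify:
  "has_loop (identify c G) \<longleftrightarrow> (\<exists>e \<in># G. c (fst e) = c (snd e))"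
  by (induction G) auto

lemma graph_invariant_simps [simp]:
  "graph_invariant {#} = 1"
  "graph_invariant (add_mset e G) = bracket (fst e) (snd e) * graph_invariant G"
  by (simp_all add: graph_invariant_def bracket_def case_prod_beta)

lemma bracket_same [simp]: "bracket t t = 0"
  by (simp add: bracket_def)

lemma bracket_swap: "bracket t h = - bracket h t"
  by (simp add: bracket_def)

lemma pluecker: "bracket a d * bracket b c = bracket a c * bracket b d - bracket a b * bracket c d"
  by (simp add: bracket_def algebra_simps)

lemma graph_invariant_loop: "has_loop G \<Longrightarrow> graph_invariant G = 0"
  by (induction G) auto

lemma valence_eq_count: "\<not> has_loop G \<Longrightarrow> valence G i = count (endpoints G) i"
  by (induction G) (auto simp: valence_def)

text \<open>The zero counts beyond \<open>length v\<close> encode the bound on the vertices, so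
  vertex set and multidegree become one condition on \<open>endpoints G\<close>.\<close>

lemma in_graphs_of_multidegree:
  "G \<in> graphs_of_multidegree v \<longleftrightarrow>
    \<not> has_loop G \<and> (\<forall>i. count (endpoints G) i = (if i < length v then v ! i else 0))"
proof -
  have "(\<forall>e \<in># G. fst e < r \<and> snd e < r) \<longleftrightarrow> (\<forall>i. i \<ge> r \<longrightarrow> count (endpoints G) i = 0)" for r
    by (force simp: endpoints_def count_eq_zero_iff not_in_iff not_le)
  then show ?thesis
    by (auto simp: graphs_of_multidegree_iff is_graph_def valence_eq_count not_less)
qed

text \<open>This substitution of coordinates induces \<gamma>: points with the same image under
  \<open>c\<close> are set equal.\<close>

definition merge :: "(nat \<Rightarrow> nat) \<Rightarrow> coord \<Rightarrow> coord int_mpoly" where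
  "merge c x = (case x of U i \<Rightarrow> Var (U (c i)) | V i \<Rightarrow> Var (V (c i)))"

lemma poly_hom_merge: "poly_hom (merge c) (graph_invariant G) = graph_invariant (identify c G)"
  by (induction G)
    (simp_all add: poly_hom_mult poly_hom_diff bracket_def merge_def)

lemma lift_graph:
  assumes "endpoints G = image_mset c M"
  shows "\<exists>H. identify c H = G \<and> endpoints H = M"
  using assms
proof (induction G arbitrary: M)
  case empty
  then show ?case by (intro exI[of _ "{#}"]) simp
next
  case (add e G)
  then obtain a M1 where a: "M = add_mset a M1" "c a = fst e"
    "image_mset c M1 = add_mset (snd e) (endpoints G)"
    using msed_map_invR[of c M "fst e" "add_mset (snd e) (endpoints G)"] by auto
  then obtain b M2 where b: "M1 = add_mset b M2" "c b = snd e" "image_mset c M2 = endpoints G"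
    using msed_map_invR[of c M1 "snd e" "endpoints G"] by auto
  obtain H where "identify c H = G" "endpoints H = M2"
    using add.IH[of M2] b by auto
  then show ?case
    using a b by (intro exI[of _ "add_mset (a, b) H"]) simp
qed

section \<open>Linear independence of non-nesting graphs\<close>

text \<open>Sorted lexicographically, the edges of such a graph have weakly increasing tails and
  heads, so they are the columns of a two-row semistandard tableau. Their invariants are the
  classical standard monomials.\<close>

definition nonnesting :: "graph \<Rightarrow> bool" where
  "nonnesting G \<longleftrightarrow> (\<forall>e \<in># G. fst e < snd e)
     \<and> (\<forall>e \<in># G. \<forall>f \<in># G. \<not> (fst e < fst f \<and> snd f < snd e))"

text \<open>An edge with the least tail and an edge with the least head would be nested if they
  differed in both coordinates, so one of them attains both minima.\<close>

lemma nonnesting_Min_edge: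
  assumes "nonnesting G" and "G \<noteq> {#}"
  shows "(Min (fst ` set_mset G), Min (snd ` set_mset G)) \<in># G"
proof -
  have "Min (fst ` set_mset G) \<in> fst ` set_mset G" "Min (snd ` set_mset G) \<in> snd ` set_mset G"
    using assms(2) by (intro Min_in; simp)+
  then obtain e f where ef: "e \<in># G" "f \<in># G"
    "fst e = Min (fst ` set_mset G)" "snd f = Min (snd ` set_mset G)"
    by (elim imageE) simp
  then have le: "fst e \<le> fst f" "snd f \<le> snd e" by simp_all
  have "\<not> (fst e < fst f \<and> snd f < snd e)"
    using assms(1) ef unfolding nonnesting_def by blast
  with le have "fst f = fst e \<or> snd e = snd f" by linarith
  then show ?thesis
    using ef by (metis prod.collapse)
qed

text \<open>The minimal edge is determined by the tails and the heads alone, so it can be removed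
  from both graphs at once.\<close>

lemma nonnesting_eqI:
  assumes "nonnesting G" "nonnesting H"
    and "image_mset fst G = image_mset fst H" "image_mset snd G = image_mset snd H"
  shows "G = H"
  using assms
proof (induction "size G" arbitrary: G H)
  case 0
  then show ?case by simp
next
  case (Suc k)
  define e where "e = (Min (fst ` set_mset G), Min (snd ` set_mset G))"
  have sets: "fst ` set_mset G = fst ` set_mset H" "snd ` set_mset G = snd ` set_mset H"
    using Suc.prems(3,4) by (metis set_image_mset)+
  have "G \<noteq> {#}" "H \<noteq> {#}" using Suc by auto
  then have "e \<in># G" "e \<in># H"
    using nonnesting_Min_edge[of G] nonnesting_Min_edge[of H] Suc.prems(1,2)
    unfolding e_def by (simp_all add: sets)
  then obtain G' H' where GH: "G = add_mset e G'" "H = add_mset e H'"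
    by (metis multi_member_split)
  have "nonnesting G'" "nonnesting H'"
    using Suc.prems(1,2) unfolding GH nonnesting_def by auto
  then have "G' = H'"
    using Suc.hyps(1)[of G' H'] Suc.hyps(2) Suc.prems(3,4) unfolding GH by simp
  then show ?case by (simp add: GH)
qed

section \<open>Leading terms of invariants\<close>

lemma coeff_mult_le:
  assumes "degree p \<le> m" "degree q \<le> n"
  shows "coeff (p * q) (m + n) = coeff p m * coeff q n"
proof -
  have "coeff p i * coeff q (m + n - i) = (if i = m then coeff p m * coeff q n else 0)"
    if "i \<le> m + n" for i
    using assms that coeff_eq_0[of p i] coeff_eq_0[of q "m + n - i"] by (cases i m rule: linorder_cases) auto
  then show ?thesis by (simp add: coeff_mult sum.delta)
qed

lemma coeff_prod_mset_le:
  assumes "\<And>x. x \<in># M \<Longrightarrow> degree (f x) \<le> n x"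
  shows "degree (\<Prod>x\<in>#M. f x) \<le> (\<Sum>x\<in>#M. n x) \<and>
    coeff (\<Prod>x\<in>#M. f x) (\<Sum>x\<in>#M. n x) = (\<Prod>x\<in>#M. coeff (f x) (n x))"
  using assms
proof (induction M)
  case (add x M)
  then show ?case
    using degree_mult_le[of "f x" "\<Prod>x\<in>#M. f x"] by (force simp: coeff_mult_le)
qed simp

text \<open>Grading by the sum of the indices of the \<open>U\<close>-variables turns the leading term of the
  invariant of a graph with edges \<open>t < h\<close> into its term of top degree.\<close>

definition sweep :: "coord \<Rightarrow> coord int_mpoly poly" where
  "sweep x = (case x of U i \<Rightarrow> monom (Var (U i)) i | V i \<Rightarrow> monom (Var (V i)) 0)"

lemma sweep_bracket:
  assumes "t < h"
  shows "degree (poly_hom sweep (bracket t h)) \<le> h"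
    and "coeff (poly_hom sweep (bracket t h)) h = Var (U h) * Var (V t)"
proof -
  have *: "poly_hom sweep (bracket t h)
      = monom (Var (U h) * Var (V t)) h - monom (Var (U t) * Var (V h)) t"
    by (simp add: bracket_def poly_hom_diff poly_hom_mult sweep_def mult_monom)
  show "degree (poly_hom sweep (bracket t h)) \<le> h"
    unfolding * using assms
    by (intro degree_diff_le) (auto intro: order_trans[OF degree_monom_le])
  show "coeff (poly_hom sweep (bracket t h)) h = Var (U h) * Var (V t)"
    unfolding * using assms by (simp add: coeff_monom)
qed

text \<open>The exponents of the \<open>U\<close> variables record the heads and those of the
  \<open>V\<close> variables the tails. By \<open>nonnesting_eqI\<close> this monomial determines a
  non-nesting graph.\<close>

lemma lead_monomial:
  "\<exists>m. (\<Prod>e\<in>#G. Var (U (snd e)) * Var (V (fst e)) :: coord int_mpoly) = Poly_Mapping.single m 1 \<and>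
    (\<forall>i. Poly_Mapping.lookup m (U i) = count (image_mset snd G) i) \<and>
    (\<forall>i. Poly_Mapping.lookup m (V i) = count (image_mset fst G) i)"
proof (induction G)
  case empty
  show ?case by (intro exI[of _ 0]) simp
next
  case (add e G)
  then obtain m where m:
    "(\<Prod>e\<in>#G. Var (U (snd e)) * Var (V (fst e)) :: coord int_mpoly) = Poly_Mapping.single m 1"
    "\<And>i. Poly_Mapping.lookup m (U i) = count (image_mset snd G) i"
    "\<And>i. Poly_Mapping.lookup m (V i) = count (image_mset fst G) i" by blast
  let ?m = "Poly_Mapping.single (U (snd e)) 1 + Poly_Mapping.single (V (fst e)) 1 + m"
  show ?case
    using m by (intro exI[of _ ?m]) (simp add: Var_def mult_single lookup_add lookup_single when_def)
qed

lemma sweep_graph_invariant: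
  assumes "nonnesting G"
  shows "degree (poly_hom sweep (graph_invariant G)) \<le> (\<Sum>e\<in>#G. snd e)"
    and "coeff (poly_hom sweep (graph_invariant G)) (\<Sum>e\<in>#G. snd e)
      = (\<Prod>e\<in>#G. Var (U (snd e)) * Var (V (fst e)))"
proof -
  have inv: "graph_invariant G = (\<Prod>e\<in>#G. bracket (fst e) (snd e))"
    by (induction G) simp_all
  have lt: "fst e < snd e" if "e \<in># G" for e
    using assms that by (simp add: nonnesting_def)
  have "(\<Prod>e\<in>#G. coeff (poly_hom sweep (bracket (fst e) (snd e))) (snd e))
      = (\<Prod>e\<in>#G. Var (U (snd e)) * Var (V (fst e)))"
    using lt by (intro arg_cong[where f = prod_mset] image_mset_cong) (simp add: sweep_bracket)
  moreover have "degree (poly_hom sweep (bracket (fst e) (snd e))) \<le> snd e" if "e \<in># G" for e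
    using lt[OF that] by (rule sweep_bracket)
  note coeff_prod_mset_le[of G "\<lambda>e. poly_hom sweep (bracket (fst e) (snd e))" snd, OF this]
  ultimately show "degree (poly_hom sweep (graph_invariant G)) \<le> (\<Sum>e\<in>#G. snd e)"
    and "coeff (poly_hom sweep (graph_invariant G)) (\<Sum>e\<in>#G. snd e)
      = (\<Prod>e\<in>#G. Var (U (snd e)) * Var (V (fst e)))"
    unfolding inv poly_hom_prod_mset by simp_all
qed

text \<open>Among the graphs with nonzero coefficient take \<open>H\<close> of largest sweep degree
  and read off the coefficient of its leading monomial \<open>m\<close>. Graphs of lower degree
  contribute nothing there, and the others of equal degree have different leading monomials.\<close>

lemma nonnesting_independent:
  assumes "finite F" and "\<And>G. G \<in> F \<Longrightarrow> nonnesting G"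
    and "(\<Sum>G\<in>F. of_int (b G) * graph_invariant G) = 0" and "G \<in> F"
  shows "b G = 0"
proof (rule ccontr)
  assume "b G \<noteq> 0"
  define N where "N H = (\<Sum>e\<in>#H. snd e)" for H :: graph
  define L :: "graph \<Rightarrow> coord int_mpoly"
    where "L H = (\<Prod>e\<in>#H. Var (U (snd e)) * Var (V (fst e)))" for H
  define F' where "F' = {H \<in> F. b H \<noteq> 0}"
  have "finite F'" "F' \<noteq> {}" using assms(1,4) \<open>b G \<noteq> 0\<close> by (auto simp: F'_def)
  then have "Max (N ` F') \<in> N ` F'" by (intro Max_in) auto
  then obtain H where H: "H \<in> F'" "N H = Max (N ` F')" by auto
  have max: "N K \<le> N H" if "K \<in> F" "b K \<noteq> 0" for K
    using that \<open>finite F'\<close> unfolding H(2) by (intro Max_ge) (auto simp: F'_def)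
  obtain m where m: "L H = Poly_Mapping.single m 1"
    "\<And>i. Poly_Mapping.lookup m (U i) = count (image_mset snd H) i"
    "\<And>i. Poly_Mapping.lookup m (V i) = count (image_mset fst H) i"
    using lead_monomial[of H] unfolding L_def by blast
  have "0 = coeff (poly_hom sweep (\<Sum>G\<in>F. of_int (b G) * graph_invariant G)) (N H)"
    by (simp add: assms(3))
  also have "\<dots> = (\<Sum>K\<in>F. of_int (b K) * coeff (poly_hom sweep (graph_invariant K)) (N H))"
    by (simp add: poly_hom_sum coeff_sum poly_hom_mult poly_hom_of_int coeff_of_int_mult)
  finally have "0 = Poly_Mapping.lookup \<dots> m" by simp
  also have "\<dots> = (\<Sum>K\<in>F. if K = H then b K else 0)"
    unfolding lookup_sum
  proof (rule sum.cong[OF refl])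
    fix K assume K: "K \<in> F"
    have "Poly_Mapping.lookup (of_int (b K) * coeff (poly_hom sweep (graph_invariant K)) (N H)) m
        = (if K = H then b K else 0)" if "b K \<noteq> 0"
    proof (cases "N K = N H")
      case True
      obtain k where k: "L K = Poly_Mapping.single k 1"
        "\<And>i. Poly_Mapping.lookup k (U i) = count (image_mset snd K) i"
        "\<And>i. Poly_Mapping.lookup k (V i) = count (image_mset fst K) i"
        using lead_monomial[of K] unfolding L_def by blast
      have "k = m \<longleftrightarrow> K = H"
      proof
        assume "k = m"
        then have "image_mset snd K = image_mset snd H" "image_mset fst K = image_mset fst H"
          using m(2,3) k(2,3) by (auto intro!: multiset_eqI)
        then show "K = H"
          using nonnesting_eqI assms(2) K H(1) by (auto simp: F'_def)
      next
        assume "K = H"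
        then have "Poly_Mapping.keys (Poly_Mapping.single k (1::int)) = Poly_Mapping.keys (Poly_Mapping.single m (1::int))"
          using m(1) k(1) by simp
        then show "k = m" by simp
      qed
      moreover have "coeff (poly_hom sweep (graph_invariant K)) (N H) = L K"
        using sweep_graph_invariant(2)[of K] assms(2) K True unfolding N_def L_def by simp
      moreover have "of_int (b K) * L K = Poly_Mapping.single k (b K)"
        by (simp flip: single_of_int add: mult_single k(1))
      ultimately show ?thesis by (simp add: lookup_single when_def)
    next
      case False
      with max[OF K that] have "N K < N H" by simp
      then have "coeff (poly_hom sweep (graph_invariant K)) (N H) = 0"
        using sweep_graph_invariant(1)[of K] assms(2) K unfolding N_def
        by (intro coeff_eq_0) (auto intro: le_less_trans)
      then show ?thesis using False by auto
    qed
    then show "Poly_Mapping.lookup (of_int (b K) * coeff (poly_hom sweep (graph_invariant K)) (N H)) m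
        = (if K = H then b K else 0)"
      by (cases "b K = 0") auto
  qed
  also have "\<dots> = b H"
    using assms(1) H(1) by (simp add: F'_def)
  finally show False using H(1) by (simp add: F'_def)
qed

section \<open>The kernel of vertex identification\<close>

interpretation int_mpoly_module: module "\<lambda>(c::int) (p::coord int_mpoly). of_int c * p"
  by (rule int_module)

abbreviation int_span :: "coord int_mpoly set \<Rightarrow> coord int_mpoly set" where
  "int_span \<equiv> module.span (\<lambda>(c::int) p. of_int c * p)"

text \<open>This is the evident part of the kernel of \<open>merge c\<close>: identification gives
  each of these graphs a loop, and the invariant of a graph with a loop vanishes.
  \<open>merge_kernel\<close> shows that no other combination of invariants of graphs with endpoints
  \<open>E\<close> lies in the kernel.\<close>

definition loop_span :: "(nat \<Rightarrow> nat) \<Rightarrow> nat multiset \<Rightarrow> coord int_mpoly set" where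
  "loop_span c E = int_span (graph_invariant ` {G. endpoints G = E \<and> has_loop (identify c G)})"

text \<open>\<open>P\<close> pairs the edges of two graphs; an entry \<open>(x, a)\<close> says that
  the endpoint \<open>x\<close> in the first graph corresponds to \<open>a\<close> in the
  second.\<close>

definition half_edges :: "((nat \<times> nat) \<times> (nat \<times> nat)) multiset \<Rightarrow> (nat \<times> nat) multiset" where
  "half_edges P = image_mset (\<lambda>p. (fst (fst p), fst (snd p))) P
    + image_mset (\<lambda>p. (snd (fst p), snd (snd p))) P"

lemma half_edges_add_mset [simp]:
  "half_edges (add_mset ((x, y), (x', y')) P) = add_mset (x, x') (add_mset (y, y') (half_edges P))"
  by (simp add: half_edges_def)

lemma image_half_edges:
  "image_mset fst (half_edges P) = endpoints (image_mset fst P)"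
  "image_mset snd (half_edges P) = endpoints (image_mset snd P)"
  by (simp_all add: half_edges_def endpoints_def image_mset.compositionality comp_def)

lemma half_edges_memD:
  "(x, a) \<in># half_edges P \<Longrightarrow>
    \<exists>p y y'. p \<in># P \<and> (p = ((x, y), (a, y')) \<or> p = ((y, x), (y', a)))"
  by (fastforce simp: half_edges_def)

definition discrepancy :: "((nat \<times> nat) \<times> (nat \<times> nat)) multiset \<Rightarrow> coord int_mpoly" where
  "discrepancy P = graph_invariant (image_mset fst P) - graph_invariant (image_mset snd P)"

text \<open>Induction on the number of mismatched half-edges. If \<open>x\<close> stands where the
  second graph has \<open>a\<close>, then \<open>a\<close> stands in a wrong place elsewhere in the
  first graph. Exchanging the two repairs at least one mismatch and, by a Pluecker relation, costs
  the invariant of a graph with the edge \<open>(x, a)\<close>, which lies inside a fibre of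
  \<open>c\<close>.\<close>

lemma discrepancy_in_loop_span:
  assumes "\<And>p. p \<in># P \<Longrightarrow> map_prod c c (fst p) = map_prod c c (snd p)"
    and "endpoints (image_mset fst P) = E" "endpoints (image_mset snd P) = E"
  shows "discrepancy P \<in> loop_span c E"
  using assms
proof (induction "size (filter_mset (\<lambda>h. fst h \<noteq> snd h) (half_edges P))" arbitrary: P
    rule: less_induct)
  case less
  let ?m = "\<lambda>P. size (filter_mset (\<lambda>h. fst h \<noteq> snd h) (half_edges P))"
  have minus: "- x \<in> loop_span c E" if "x \<in> loop_span c E" for x
    using that unfolding loop_span_def by (rule int_mpoly_module.span_neg)
  show ?case
  proof (cases "\<exists>h \<in># half_edges P. fst h \<noteq> snd h")
    case False
    have "fst p = snd p" if "p \<in># P" for p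
    proof -
      have "(fst (fst p), fst (snd p)) \<in># half_edges P" "(snd (fst p), snd (snd p)) \<in># half_edges P"
        using that by (simp_all add: half_edges_def)
      with False show ?thesis by (metis fst_conv snd_conv prod_eqI)
    qed
    then have "image_mset fst P = image_mset snd P" by (intro image_mset_cong) auto
    then show ?thesis
      by (simp add: discrepancy_def loop_span_def int_mpoly_module.span_zero)
  next
    case True
    then obtain x a where xa: "(x, a) \<in># half_edges P" "x \<noteq> a" by auto
    \<comment> \<open>Otherwise every half-edge with \<open>a\<close> on the left has
      \<open>a\<close> on the right, and \<open>(x, a)\<close> adds a further \<open>a\<close> on
      the right, although both graphs have the same endpoints.\<close>
    have "\<exists>z. (a, z) \<in># half_edges P \<and> z \<noteq> a"
    proof (rule ccontr)
      assume "\<not> ?thesis"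
      then have "snd h = a" if "h \<in># half_edges P" "fst h = a" for h
        using that by (cases h) auto
      then have "filter_mset (\<lambda>h. fst h = a) (half_edges P)
          = filter_mset (\<lambda>h. fst h = a) (filter_mset (\<lambda>h. snd h = a) (half_edges P))"
        by (auto simp: filter_filter_mset intro!: filter_mset_cong)
      also have "\<dots> \<subset># filter_mset (\<lambda>h. snd h = a) (half_edges P)"
        using xa by (intro subset_mset.le_neq_trans) (auto simp: filter_mset_eq_conv)
      finally have "count (image_mset fst (half_edges P)) a < count (image_mset snd (half_edges P)) a"
        using mset_subset_size by (force simp: count_image_mset' count_conv_size_mset filter_mset_image_mset)
      then show False using less.prems(2,3) by (simp add: image_half_edges)
    qed
    then obtain z where z: "(a, z) \<in># half_edges P" "z \<noteq> a" by blast
    \<comment> \<open>The exchange when both mismatched half-edges are tails of two different pairs.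
      Only the first graph changes: \<open>(x, a)\<close> becomes \<open>(a, a)\<close> and
      \<open>(a, z)\<close> becomes \<open>(x, z)\<close>.\<close>
    have swap: "discrepancy Q \<in> loop_span c E"
      if Q: "Q = add_mset ((x, y), (a, y')) (add_mset ((a, t), (z, t')) R)"
        and ok: "\<forall>p \<in># Q. map_prod c c (fst p) = map_prod c c (snd p)"
          "endpoints (image_mset fst Q) = E" "endpoints (image_mset snd Q) = E" "?m Q = ?m P"
      for Q R y y' t t'
    proof -
      let ?Q = "add_mset ((a, y), (a, y')) (add_mset ((x, t), (z, t')) R)"
      let ?G = "add_mset (x, a) (add_mset (y, t) (image_mset fst R))"
      have "?m ?Q < ?m P"
        using xa(2) z(2) unfolding ok(4)[symmetric] Q by simp
      then have "discrepancy ?Q \<in> loop_span c E"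
        using ok(1-3) unfolding Q by (intro less.hyps) auto
      moreover have "discrepancy Q = discrepancy ?Q + graph_invariant ?G"
        unfolding Q discrepancy_def by (simp add: bracket_def algebra_simps)
      moreover have "graph_invariant ?G \<in> loop_span c E"
        unfolding loop_span_def using ok(1-3) unfolding Q
        by (intro int_mpoly_module.span_base imageI) auto
      ultimately show ?thesis
        by (simp add: loop_span_def int_mpoly_module.span_add)
    qed
    obtain p y y' where p: "p \<in># P" "p = ((x, y), (a, y')) \<or> p = ((y, x), (y', a))"
        using half_edges_memD[OF xa(1)] by blast
      obtain q t t' where q: "q \<in># P" "q = ((a, t), (z, t')) \<or> q = ((t, a), (t', z))"
        using half_edges_memD[OF z(1)] by blast
      show ?thesis
      proof (cases "p = q")
        case True
        with p q xa(2) z(2) have "y = a" by auto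
        have "c y = c x" using less.prems(1)[OF p(1)] p(2) \<open>y = a\<close> by auto
        have "\<exists>e \<in># image_mset f P. c (fst e) = c (snd e)" if "f = fst \<or> f = snd" for f
          using p that \<open>c y = c x\<close> \<open>y = a\<close> less.prems(1)[OF p(1)] by (auto intro!: bexI[of _ p])
        then have "graph_invariant (image_mset f P) \<in> loop_span c E" if "f = fst \<or> f = snd" for f
          unfolding loop_span_def using that less.prems(2,3)
          by (intro int_mpoly_module.span_base imageI) (auto simp: has_loop_identify)
        then show ?thesis
          unfolding discrepancy_def loop_span_def by (intro int_mpoly_module.span_diff) auto
      next
        case False
        then obtain R where R: "P = add_mset p (add_mset q R)"
          using p(1) q(1) by (metis insert_noteq_member multi_member_split)
        \<comment> \<open>Both pairs are oriented so that the mismatched half-edges are tails.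
          Reversing corresponding edges in both graphs at once changes the discrepancy only by a
          sign.\<close>
        let ?Q = "add_mset ((x, y), (a, y')) (add_mset ((a, t), (z, t')) R)"
        have "map_prod c c (fst r) = map_prod c c (snd r)" if "r \<in># ?Q" for r
          using that p(2) q(2) less.prems(1)[of p] less.prems(1)[of q] less.prems(1)[of r]
          unfolding R by auto
        moreover have "endpoints (image_mset fst ?Q) = endpoints (image_mset fst P)"
          "endpoints (image_mset snd ?Q) = endpoints (image_mset snd P)" "?m ?Q = ?m P"
          using p(2) q(2) unfolding R by (elim disjE; simp add: add_mset_commute)+
        ultimately have "discrepancy ?Q \<in> loop_span c E"
          using less.prems(2,3) by (intro swap[OF refl]) simp_all
        moreover have "discrepancy P = discrepancy ?Q \<or> discrepancy P = - discrepancy ?Q"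
          using p(2) q(2) unfolding R
          by (elim disjE) (simp_all add: discrepancy_def bracket_swap[of y x] bracket_swap[of y' a]
              bracket_swap[of t a] bracket_swap[of t' z])
        ultimately show ?thesis using minus[of "discrepancy ?Q"] by auto
      qed
  qed
qed

text \<open>Two lifts of the same graph differ by swaps of endpoints within fibres of \<open>c\<close>, and each swap
  changes the invariant by that of a graph with an edge inside a fibre.\<close>

lemma same_identification:
  assumes "identify c G = identify c H" "endpoints G = E" "endpoints H = E"
  shows "graph_invariant G - graph_invariant H \<in> loop_span c E"
proof -
  \<comment> \<open>Equal images as multisets give a bijection between the edges, realised as a
    multiset \<open>P\<close> of pairs with equal images.\<close>
  have "rel_mset (\<lambda>e f. map_prod c c e = map_prod c c f) G H"
    using assms(1) unfolding identify_def multiset.rel_eq[symmetric] multiset.rel_map by simp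
  then obtain P where P: "set_mset P \<subseteq> {(e, f). map_prod c c e = map_prod c c f}"
    "image_mset fst P = G" "image_mset snd P = H"
    unfolding multiset.in_rel by blast
  then have "map_prod c c (fst p) = map_prod c c (snd p)" if "p \<in># P" for p
    using that by auto
  from discrepancy_in_loop_span[of P c E, OF this] P assms(2,3) show ?thesis
    unfolding discrepancy_def by simp
qed

text \<open>Among edges of equal total length, nested ones have the larger sum of squares; the extra 1
  makes reversing a backward edge an improvement.\<close>

definition spread :: "nat \<Rightarrow> nat \<Rightarrow> nat" where
  "spread t h = (if t \<le> h then (h - t)\<^sup>2 else (t - h)\<^sup>2 + 1)"

text \<open>In terms of the gaps \<open>p\<close>, \<open>q\<close>, \<open>r\<close> between
  consecutive points, the first exchange lowers the sum of squares by \<open>2 * p * r\<close>, and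
  the second leaves only the squares of \<open>p\<close> and \<open>r\<close>.\<close>

lemma spread_unnest:
  assumes "a < b" "b < x" "x < d"
  shows "spread a x + spread b d < spread a d + spread b x"
    and "spread a b + spread x d < spread a d + spread b x"
proof -
  obtain p where p: "b = a + p" "p > 0" using assms(1) less_imp_add_positive by blast
  obtain q where q: "x = b + q" "q > 0" using assms(2) less_imp_add_positive by blast
  obtain r where r: "d = x + r" "r > 0" using assms(3) less_imp_add_positive by blast
  have "p * r > 0" using p r by simp
  then show "spread a x + spread b d < spread a d + spread b x"
    and "spread a b + spread x d < spread a d + spread b x"
    unfolding p(1) q(1) r(1) by (simp_all add: spread_def power2_eq_square algebra_simps)
qed

text \<open>Fixing one lift per graph gives straightening a single representative to end in; any
  other lift with the same endpoints has an invariant that differs by an element of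
  \<open>loop_span\<close>.\<close>

definition lift :: "(nat \<Rightarrow> nat) \<Rightarrow> nat multiset \<Rightarrow> graph \<Rightarrow> graph" where
  "lift c E H = (SOME G. endpoints G = E \<and> identify c G = H)"

lemma lift:
  assumes "endpoints G = E"
  shows "endpoints (lift c E (identify c G)) = E"
    and "identify c (lift c E (identify c G)) = identify c G"
  using someI[of "\<lambda>K. endpoints K = E \<and> identify c K = identify c G" G] assms
  unfolding lift_def by blast+

definition standard_graphs :: "(nat \<Rightarrow> nat) \<Rightarrow> nat multiset \<Rightarrow> graph set" where
  "standard_graphs c E = {identify c G | G. endpoints G = E \<and> nonnesting (identify c G)}"

text \<open>Induction on the total spread of the identified edges. Reversals and Pluecker relations
  are applied to \<open>G\<close> itself, while order and nesting are judged after identification.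
  Once the image is non-nesting, \<open>same_identification\<close> replaces \<open>G\<close> by the
  chosen lift.\<close>

lemma straighten:
  assumes "endpoints G = E"
  shows "graph_invariant G \<in> int_span (graph_invariant ` {G. endpoints G = E \<and> has_loop (identify c G)}
    \<union> (\<lambda>H. graph_invariant (lift c E H)) ` standard_graphs c E)"
  using assms
proof (induction "\<Sum>e\<in>#G. spread (c (fst e)) (c (snd e))" arbitrary: G rule: less_induct)
  case less
  let ?L = "graph_invariant ` {G. endpoints G = E \<and> has_loop (identify c G)}"
  let ?S = "(\<lambda>H. graph_invariant (lift c E H)) ` standard_graphs c E"
  have loop_span: "x \<in> int_span (?L \<union> ?S)" if "x \<in> loop_span c E" for x
    using that int_mpoly_module.span_mono[of ?L "?L \<union> ?S"] unfolding loop_span_def by blast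
  consider (loop) "has_loop (identify c G)"
    | (backward) e where "e \<in># G" "c (snd e) < c (fst e)"
    | (nest) e f where "e \<in># G" "f \<in># G" "c (fst e) < c (fst f)" "c (snd f) < c (snd e)"
        "c (fst f) < c (snd f)"
    | (standard) "nonnesting (identify c G)"
  proof -
    have "nonnesting (identify c G)" if "\<not> has_loop (identify c G)"
      "\<And>e. e \<in># G \<Longrightarrow> \<not> c (snd e) < c (fst e)"
      "\<And>e f. e \<in># G \<Longrightarrow> f \<in># G \<Longrightarrow> c (fst f) < c (snd f) \<Longrightarrow>
        \<not> (c (fst e) < c (fst f) \<and> c (snd f) < c (snd e))"
    proof -
      have "c (fst e) < c (snd e)" if "e \<in># G" for e
        using \<open>\<not> has_loop (identify c G)\<close> that(1) \<open>\<And>e. e \<in># G \<Longrightarrow> \<not> c (snd e) < c (fst e)\<close>[OF that]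
        unfolding has_loop_identify by (metis linorder_neqE_nat)
      with that(3) show ?thesis
        unfolding nonnesting_def identify_def by auto
    qed
    then show thesis using loop backward nest standard by blast
  qed
  then show ?case
  proof cases
    case loop
    then show ?thesis using less.prems by (intro int_mpoly_module.span_base) auto
  next
    case backward
    obtain R where R: "G = add_mset e R" using backward(1) by (metis multi_member_split)
    let ?G = "add_mset (snd e, fst e) R"
    have "graph_invariant ?G \<in> int_span (?L \<union> ?S)"
      using less.prems backward(2) unfolding R
      by (intro less.hyps) (simp_all add: R spread_def add_mset_commute)
    moreover have "graph_invariant G = - graph_invariant ?G"
      unfolding R by (simp add: bracket_swap[of "fst e" "snd e"])
    ultimately show ?thesis by (simp only: int_mpoly_module.span_neg)
  next
    case nest
    then have "e \<noteq> f" by auto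
    with nest(1,2) obtain R where R: "G = add_mset e (add_mset f R)"
      by (metis insert_noteq_member multi_member_split)
    let ?G = "add_mset (fst e, snd f) (add_mset (fst f, snd e) R)"
    let ?H = "add_mset (fst e, fst f) (add_mset (snd f, snd e) R)"
    note spread = spread_unnest[OF nest(3,5,4)]
    have "graph_invariant ?G \<in> int_span (?L \<union> ?S)"
      using less.prems spread(1) unfolding R
      by (intro less.hyps) (simp_all add: R add_mset_commute)
    moreover have "graph_invariant ?H \<in> int_span (?L \<union> ?S)"
      using less.prems spread(2) unfolding R
      by (intro less.hyps) (simp_all add: R add_mset_commute)
    moreover have "graph_invariant G = graph_invariant ?G - graph_invariant ?H"
      unfolding R
      by (simp only: graph_invariant_simps fst_conv snd_conv mult.assoc[symmetric]
          pluecker[of "fst e" "snd e" "fst f" "snd f"] left_diff_distrib)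
    ultimately show ?thesis by (simp only: int_mpoly_module.span_diff)
  next
    case standard
    let ?G = "lift c E (identify c G)"
    have "graph_invariant G - graph_invariant ?G \<in> int_span (?L \<union> ?S)"
      using lift[OF less.prems, of c] less.prems by (intro loop_span same_identification) simp_all
    moreover have "graph_invariant ?G \<in> int_span (?L \<union> ?S)"
      using standard less.prems
      by (intro int_mpoly_module.span_base) (auto simp: standard_graphs_def)
    ultimately have "(graph_invariant G - graph_invariant ?G) + graph_invariant ?G \<in> int_span (?L \<union> ?S)"
      by (rule int_mpoly_module.span_add)
    then show ?thesis by simp
  qed
qed

text \<open>Straightening writes \<open>f\<close> as a part \<open>l\<close> with loops plus a
  combination \<open>g\<close> of chosen lifts. \<open>merge c\<close> kills \<open>l\<close> and
  sends the lifts to invariants of distinct non-nesting graphs, whose independence forces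
  \<open>g = 0\<close>.\<close>

lemma merge_kernel:
  assumes "f \<in> int_span (graph_invariant ` {G. endpoints G = E})"
    and "poly_hom (merge c) f = 0"
  shows "f \<in> loop_span c E"
proof -
  let ?L = "graph_invariant ` {G. endpoints G = E \<and> has_loop (identify c G)}"
  let ?h = "\<lambda>H. graph_invariant (lift c E H)"
  have "int_span (graph_invariant ` {G. endpoints G = E}) \<subseteq> int_span (?L \<union> ?h ` standard_graphs c E)"
    using straighten by (intro int_mpoly_module.span_minimal) auto
  with assms(1) obtain l g where lg: "f = l + g" "l \<in> int_span ?L"
    "g \<in> int_span (?h ` standard_graphs c E)"
    unfolding int_mpoly_module.span_Un by blast
  obtain T b where "finite T" "T \<subseteq> ?h ` standard_graphs c E" "g = (\<Sum>x\<in>T. of_int (b x) * x)"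
    using lg(3) unfolding int_mpoly_module.span_explicit by blast
  \<comment> \<open>The sum runs over invariants; selecting one graph for each of them turns it into
    a sum over distinct standard graphs.\<close>
  moreover obtain F where "F \<subseteq> standard_graphs c E" "inj_on ?h F" "T = ?h ` F"
    using calculation(2) unfolding subset_image_inj by blast
  ultimately have F: "finite F" "F \<subseteq> standard_graphs c E" "g = (\<Sum>H\<in>F. of_int (b (?h H)) * ?h H)"
    by (simp_all add: finite_image_iff sum.reindex)
  have "poly_hom (merge c) l = 0"
  proof -
    have "int_span ?L \<subseteq> {p. poly_hom (merge c) p = 0}"
      by (intro int_mpoly_module.span_minimal int_mpoly_module.subspaceI)
        (auto simp: poly_hom_merge graph_invariant_loop poly_hom_add poly_hom_mult)
    with lg(2) show ?thesis by blast
  qed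
  moreover have "poly_hom (merge c) g = (\<Sum>H\<in>F. of_int (b (?h H)) * graph_invariant H)"
  proof -
    have "poly_hom (merge c) (?h H) = graph_invariant H" if "H \<in> F" for H
      using that F(2) lift(2)[of _ E c] by (auto simp: poly_hom_merge standard_graphs_def)
    then show ?thesis
      unfolding F(3) by (simp add: poly_hom_sum poly_hom_mult poly_hom_of_int)
  qed
  ultimately have "(\<Sum>H\<in>F. of_int (b (?h H)) * graph_invariant H) = 0"
    using assms(2) lg(1) by (simp add: poly_hom_add)
  then have "b (?h H) = 0" if "H \<in> F" for H
    using F(1,2) that by (intro nonnesting_independent[of F "\<lambda>H. b (?h H)"]) (auto simp: standard_graphs_def)
  then have "g = 0" unfolding F(3) by simp
  then show ?thesis using lg by (simp add: loop_span_def)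
qed

section \<open>Perfect matchings in regular bipartite graphs\<close>

text \<open>Rado's proof: as long as some \<open>N x\<close> has two elements, one of them can be removed without
  violating Hall's condition, by submodularity of the cardinality.\<close>

lemma hall:
  assumes "finite A" and "\<And>x. x \<in> A \<Longrightarrow> finite (N x)"
    and "\<And>I. I \<subseteq> A \<Longrightarrow> card I \<le> card (\<Union>x\<in>I. N x)"
  shows "\<exists>g. inj_on g A \<and> (\<forall>x\<in>A. g x \<in> N x)"
  using assms(2,3)
proof (induction "\<Sum>x\<in>A. card (N x)" arbitrary: N rule: less_induct)
  case less
  show ?case
  proof (cases "\<exists>x\<in>A. card (N x) \<ge> 2")
    case False
    have "\<exists>y. N x = {y}" if "x \<in> A" for x
    proof -
      have "card (N x) = 1" using less.prems(2)[of "{x}"] False that by force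
      then show ?thesis by (simp add: card_1_singleton_iff)
    qed
    then obtain g where g: "\<And>x. x \<in> A \<Longrightarrow> N x = {g x}" by metis
    have "inj_on g A"
    proof (rule inj_onI, rule ccontr)
      fix x y assume "x \<in> A" "y \<in> A" "g x = g y" "x \<noteq> y"
      then show False using less.prems(2)[of "{x, y}"] g by simp
    qed
    then show ?thesis using g by auto
  next
    case True
    then obtain x where x: "x \<in> A" "card (N x) \<ge> 2" by blast
    then obtain y z where yz: "y \<in> N x" "z \<in> N x" "y \<noteq> z"
      by (metis One_nat_def Suc_1 card_le_Suc0_iff_eq less.prems(1) not_less_eq_eq)
    let ?N = "\<lambda>y. N(x := N x - {y})"
    let ?U = "\<lambda>J. \<Union>x\<in>J. N x"
    have step: ?thesis if y: "y \<in> N x" and H: "\<And>I. I \<subseteq> A \<Longrightarrow> card I \<le> card (\<Union>v\<in>I. ?N y v)" for y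
    proof -
      have "(\<Sum>v\<in>A. card (?N y v)) < (\<Sum>v\<in>A. card (N v))"
        using assms(1) x(1) y less.prems(1)
        by (intro sum_strict_mono_ex1) (auto intro!: bexI[of _ x] card_Diff1_less card_Diff1_le simp del: card_Diff_insert)
      then have "\<exists>g. inj_on g A \<and> (\<forall>v\<in>A. g v \<in> ?N y v)"
        using less.prems(1) x(1) by (intro less.hyps H) auto
      then show ?thesis by (metis Diff_iff fun_upd_apply)
    qed
    \<comment> \<open>A violating set must contain \<open>x\<close>, because only \<open>N x\<close>
      has changed. Dropping \<open>x\<close> from it yields \<open>J\<close> and turns the strict
      inequality into a weak one.\<close>
    have fail: "\<exists>J \<subseteq> A - {x}. card ((N x - {y}) \<union> ?U J) \<le> card J"
      if "\<not> (\<forall>I \<subseteq> A. card I \<le> card (\<Union>v\<in>I. ?N y v))" for y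
    proof -
      from that obtain I where I: "I \<subseteq> A" "card (\<Union>v\<in>I. ?N y v) < card I" by (auto simp: not_le)
      have "x \<in> I"
      proof (rule ccontr)
        assume "x \<notin> I"
        then have "(\<Union>v\<in>I. ?N y v) = ?U I" by (intro SUP_cong) auto
        with I less.prems(2)[of I] show False by simp
      qed
      then have "I = insert x (I - {x})" by auto
      then have "(\<Union>v\<in>I. ?N y v) = ?N y x \<union> (\<Union>v\<in>I - {x}. ?N y v)" by blast
      also have "(\<Union>v\<in>I - {x}. ?N y v) = ?U (I - {x})" by (intro SUP_cong) auto
      finally have "(\<Union>v\<in>I. ?N y v) = (N x - {y}) \<union> ?U (I - {x})" by simp
      moreover have "card I = Suc (card (I - {x}))"
        using \<open>x \<in> I\<close> I(1) assms(1) by (metis card.remove finite_subset)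
      ultimately show ?thesis using I by (intro exI[of _ "I - {x}"]) auto
    qed
    show ?thesis
    proof (rule ccontr)
      assume "\<not> ?thesis"
      then obtain I J where IJ: "I \<subseteq> A - {x}" "card ((N x - {y}) \<union> ?U I) \<le> card I"
        "J \<subseteq> A - {x}" "card ((N x - {z}) \<union> ?U J) \<le> card J"
        using step yz(1,2) fail[of y] fail[of z] by metis
      have sub: "I \<subseteq> A" "J \<subseteq> A" "x \<notin> I \<union> J" using IJ(1,3) by auto
      then have fin: "finite I" "finite J" using assms(1) finite_subset by blast+
      with sub have finU: "finite (N x)" "finite (?U I)" "finite (?U J)"
        using x(1) less.prems(1) by blast+
      \<comment> \<open>Since \<open>y\<close> and \<open>z\<close> differ, the union recovers all
        of \<open>N x\<close>, and Hall's condition for \<open>insert x (I \<union> J)\<close> gains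
        one. The intersection contains the neighbours of \<open>I \<inter> J\<close>. Adding the two
        bounds contradicts both failures.\<close>
      let ?P = "(N x - {y}) \<union> ?U I" and ?Q = "(N x - {z}) \<union> ?U J"
      have "?P \<union> ?Q = ?U (insert x (I \<union> J))" using yz by auto
      then have "card (?P \<union> ?Q) \<ge> Suc (card (I \<union> J))"
        using less.prems(2)[of "insert x (I \<union> J)"] sub x(1) fin by simp
      moreover have "card (?P \<inter> ?Q) \<ge> card (I \<inter> J)"
        using finU sub by (intro order_trans[OF less.prems(2)[of "I \<inter> J"]] card_mono) auto
      moreover have "card ?P + card ?Q = card (?P \<union> ?Q) + card (?P \<inter> ?Q)"
        using finU by (intro card_Un_Int) auto
      moreover have "card I + card J = card (I \<union> J) + card (I \<inter> J)"
        using fin by (intro card_Un_Int) auto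
      ultimately show False using IJ(2,4) by linarith
    qed
  qed
qed

section \<open>Regular bipartite graphs\<close>

lemma size_filter_repeat_mset_set:
  assumes "finite A"
  shows "size (filter_mset P (repeat_mset d (mset_set A))) = d * card {x \<in> A. P x}"
  using assms by (induction d) simp_all

definition bipartite :: "nat set \<Rightarrow> graph \<Rightarrow> bool" where
  "bipartite B G \<longleftrightarrow> (\<forall>e \<in># G. (fst e \<in> B) \<noteq> (snd e \<in> B))"

lemma in_endpoints: "v \<in># endpoints G \<longleftrightarrow> (\<exists>e \<in># G. v = fst e \<or> v = snd e)"
  by (auto simp: endpoints_def)

lemma edge_in_support:
  assumes "finite A" "endpoints G = repeat_mset d (mset_set A)" "e \<in># G"
  shows "fst e \<in> A" "snd e \<in> A"
proof -
  have "v \<in> A" if "v \<in># repeat_mset d (mset_set A)" for v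
    using that assms(1) by (induction d) auto
  moreover have "fst e \<in># endpoints G" "snd e \<in># endpoints G"
    using assms(3) by (auto simp: in_endpoints)
  ultimately show "fst e \<in> A" "snd e \<in> A" unfolding assms(2) by blast+
qed

text \<open>Double counting: every edge end in \<open>I\<close> has its other end among the
  neighbours of \<open>I\<close>, and regularity allows the common factor \<open>Suc d\<close> to be
  cancelled. The induction runs over subgraphs \<open>H\<close> so that the neighbourhoods remain
  those of \<open>G\<close>.\<close>

lemma card_le_card_neighbours:
  assumes "finite A" "bipartite B G" "endpoints G = repeat_mset (Suc d) (mset_set A)"
    and "I \<subseteq> A \<inter> B"
  shows "card I \<le> card (\<Union>x\<in>I. {y. (x, y) \<in># G \<or> (y, x) \<in># G})"
proof -
  let ?N = "\<Union>x\<in>I. {y. (x, y) \<in># G \<or> (y, x) \<in># G}"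
  have "size (filter_mset (\<lambda>v. v \<in> I) (endpoints H)) \<le> size (filter_mset (\<lambda>v. v \<in> ?N) (endpoints H))"
    if "H \<subseteq># G" for H
    using that
  proof (induction H)
    case (add e H)
    have "e \<in># G" using add.prems by (meson mset_subset_eqD union_single_eq_member)
    obtain x y where e: "e = (x, y)" by force
    have "(x \<in> B) \<noteq> (y \<in> B)"
      using \<open>e \<in># G\<close> assms(2) unfolding e bipartite_def by fastforce
    then have "\<not> (x \<in> I \<and> y \<in> I)" using assms(4) by auto
    moreover have "x \<in> I \<longrightarrow> y \<in> ?N" "y \<in> I \<longrightarrow> x \<in> ?N"
      using \<open>e \<in># G\<close> unfolding e by blast+
    moreover have "size (filter_mset (\<lambda>v. v \<in> I) (endpoints H))
        \<le> size (filter_mset (\<lambda>v. v \<in> ?N) (endpoints H))"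
      using add by (meson mset_subset_eq_insertD subset_mset.less_imp_le)
    ultimately show ?case
      unfolding e by (simp only: endpoints_simps fst_conv snd_conv filter_mset_add_mset) auto
  qed simp
  from this[of G] have "Suc d * card {x \<in> A. x \<in> I} \<le> Suc d * card {x \<in> A. x \<in> ?N}"
    unfolding assms(3) size_filter_repeat_mset_set[OF assms(1)] by simp
  then have "card {x \<in> A. x \<in> I} \<le> card {x \<in> A. x \<in> ?N}" by (simp only: Suc_mult_le_cancel1)
  moreover have "{x \<in> A. x \<in> I} = I" using assms(4) by auto
  moreover have "?N \<subseteq> A"
  proof
    fix y assume "y \<in> ?N"
    then obtain x where "(x, y) \<in># G \<or> (y, x) \<in># G" by blast
    then show "y \<in> A"
      using edge_in_support[OF assms(1,3), of "(x, y)"] edge_in_support[OF assms(1,3), of "(y, x)"]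
      by auto
  qed
  then have "{x \<in> A. x \<in> ?N} = ?N" by auto
  ultimately show ?thesis by simp
qed

lemma perfect_matching:
  assumes "finite A" "bipartite B G" "endpoints G = repeat_mset (Suc d) (mset_set A)"
    and "card A = 2 * card (A \<inter> B)"
  shows "\<exists>M. M \<subseteq># G \<and> endpoints M = mset_set A"
proof -
  let ?B = "A \<inter> B"
  note in_A = edge_in_support[OF assms(1,3)]
  have "\<exists>g. inj_on g ?B \<and> (\<forall>x\<in>?B. g x \<in> {y. (x, y) \<in># G \<or> (y, x) \<in># G})"
  proof (rule hall)
    show "finite ?B" using assms(1) by simp
    show "finite {y. (x, y) \<in># G \<or> (y, x) \<in># G}" for x
      using in_A by (intro finite_subset[OF _ assms(1)]) force
    show "card I \<le> card (\<Union>x\<in>I. {y. (x, y) \<in># G \<or> (y, x) \<in># G})" if "I \<subseteq> ?B" for I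
      using card_le_card_neighbours[OF assms(1-3) that] .
  qed
  then obtain g where g: "inj_on g ?B" "\<And>x. x \<in> ?B \<Longrightarrow> (x, g x) \<in># G \<or> (g x, x) \<in># G" by blast
  have g_A: "g x \<in> A - B" if "x \<in> ?B" for x
    using g(2)[OF that] that in_A[of "(x, g x)"] in_A[of "(g x, x)"] assms(2)
    unfolding bipartite_def by auto
  \<comment> \<open>Hall's theorem was applied to undirected neighbourhoods; \<open>edge x\<close>
    picks an orientation that occurs in \<open>G\<close>.\<close>
  define edge where "edge x = (if (x, g x) \<in># G then (x, g x) else (g x, x))" for x
  have edge: "edge x \<in># G" "{#fst (edge x), snd (edge x)#} = {#x, g x#}" if "x \<in> ?B" for x
    using g(2)[OF that] by (auto simp: edge_def)
  have "inj_on edge ?B"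
    using g_A by (intro inj_onI) (auto simp: edge_def split: if_splits)
  \<comment> \<open>Distinct vertices give distinct edges, so the chosen edges form a set and lie in
    \<open>G\<close> whatever the multiplicities there.\<close>
  have "image_mset edge (mset_set ?B) = mset_set (edge ` ?B)"
    using \<open>inj_on edge ?B\<close> by (rule image_mset_mset_set)
  also have "\<dots> \<subseteq># mset_set (set_mset G)"
    using edge(1) by (intro subset_imp_msubset_mset_set) auto
  also have "\<dots> \<subseteq># G" by (rule mset_set_set_mset_msubset)
  finally have "image_mset edge (mset_set ?B) \<subseteq># G" .
  moreover have "endpoints (image_mset edge (mset_set ?B)) = mset_set A"
  proof -
    have "endpoints (image_mset edge (mset_set C)) = mset_set C + image_mset g (mset_set C)"
      if "C \<subseteq> ?B" for C
    proof -
      have "finite C" using that assms(1) finite_subset by blast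
      then show ?thesis using that
      proof induction
        case (insert x C)
        then show ?case using edge(2)[of x] by (simp add: edge_def)
      qed simp
    qed
    then have "endpoints (image_mset edge (mset_set ?B)) = mset_set ?B + mset_set (g ` ?B)"
      using g(1) by (simp add: image_mset_mset_set)
    \<comment> \<open>An injection into the opposite colour class, which has the same size as
      \<open>?B\<close>, is onto.\<close>
    also have "g ` ?B = A - B"
    proof (rule card_subset_eq)
      show "g ` ?B \<subseteq> A - B" using g_A by auto
      have "card A = card ?B + card (A - B)"
        using assms(1) by (metis card_Int_Diff)
      then show "card (g ` ?B) = card (A - B)" using g(1) assms(4) by (simp add: card_image)
    qed (use assms(1) in simp)
    also have "mset_set ?B + mset_set (A - B) = mset_set (?B \<union> (A - B))"
      using assms(1) by (intro mset_set_Union[symmetric]) auto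
    finally show ?thesis by (simp add: Int_Diff_Un)
  qed
  ultimately show ?thesis by blast
qed

lemma decompose_into_matchings:
  assumes "finite A" "bipartite B G" "endpoints G = repeat_mset d (mset_set A)"
    and "card A = 2 * card (A \<inter> B)"
  shows "\<exists>Ms. length Ms = d \<and> sum_list Ms = G \<and> (\<forall>M\<in>set Ms. endpoints M = mset_set A)"
  using assms(2,3)
proof (induction d arbitrary: G)
  case 0
  then have "G = {#}" by (simp add: endpoints_def)
  then show ?case by simp
next
  case (Suc d)
  obtain M where M: "M \<subseteq># G" "endpoints M = mset_set A"
    using perfect_matching[OF assms(1) Suc.prems assms(4)] by blast
  then obtain H where G: "G = M + H" by (auto simp: mset_subset_eq_exists_conv)
  have "bipartite B H" "endpoints H = repeat_mset d (mset_set A)"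
    using Suc.prems M(2) unfolding G by (auto simp: bipartite_def)
  then obtain Ms where "length Ms = d" "sum_list Ms = H" "\<forall>M\<in>set Ms. endpoints M = mset_set A"
    using Suc.IH by blast
  then show ?case using M(2) G by (intro exI[of _ "M # Ms"]) simp
qed

section \<open>Generation in degree one\<close>

text \<open>A bichromatic edge has one end of each colour, so both sides equal the number of
  bichromatic edges plus twice the number of monochromatic ones.\<close>

lemma count_monochromatic:
  "size (filter_mset (\<lambda>v. v \<in> B) (endpoints G))
      + 2 * size (filter_mset (\<lambda>e. fst e \<notin> B \<and> snd e \<notin> B) G)
    = size (filter_mset (\<lambda>v. v \<notin> B) (endpoints G))
      + 2 * size (filter_mset (\<lambda>e. fst e \<in> B \<and> snd e \<in> B) G)"
  by (induction G) auto

text \<open>Kempe's argument: by counting, a monochromatic edge has a partner of the other colour, and the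
  Pluecker relation replaces the two by bichromatic edges. The bichromatic edge \<open>e\<close> is never touched.\<close>

lemma bipartite_reduction:
  assumes "endpoints G = E" "e \<in># G" "(fst e \<in> B) \<noteq> (snd e \<in> B)"
    and "size (filter_mset (\<lambda>v. v \<in> B) E) = size (filter_mset (\<lambda>v. v \<notin> B) E)"
    and bip: "\<And>G. endpoints G = E \<Longrightarrow> e \<in># G \<Longrightarrow> bipartite B G \<Longrightarrow> P (graph_invariant G)"
    and diff: "\<And>f g. P f \<Longrightarrow> P g \<Longrightarrow> P (f - g)"
  shows "P (graph_invariant G)"
  using assms(1,2)
proof (induction "size (filter_mset (\<lambda>e. fst e \<in> B \<and> snd e \<in> B) G)" arbitrary: G rule: less_induct)
  case less
  let ?bb = "\<lambda>G. filter_mset (\<lambda>e. fst e \<in> B \<and> snd e \<in> B) G"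
  let ?ww = "\<lambda>G. filter_mset (\<lambda>e. fst e \<notin> B \<and> snd e \<notin> B) G"
  have "size (?bb G) = size (?ww G)"
    using count_monochromatic[of B G] assms(4) less.prems(1) by simp
  then have empty_iff: "?bb G = {#} \<longleftrightarrow> ?ww G = {#}"
    unfolding size_eq_0_iff_empty[symmetric] by (rule arg_cong)
  show ?case
  proof (cases "?bb G = {#}")
    case True
    with empty_iff have "?ww G = {#}" by (rule iffD1)
    with True have "bipartite B G" unfolding bipartite_def filter_mset_eq_mempty_iff by blast
    then show ?thesis using less.prems by (intro bip)
  next
    case False
    then have "?ww G \<noteq> {#}" using empty_iff by blast
    with False obtain f h where f: "f \<in># G" "fst f \<in> B" "snd f \<in> B"
      and h: "h \<in># G" "fst h \<notin> B" "snd h \<notin> B" by auto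
    then have ne: "f \<noteq> h" "e \<noteq> f" "e \<noteq> h" using assms(3) by auto
    then obtain R where R: "G = add_mset f (add_mset h R)"
      using f(1) h(1) by (metis insert_noteq_member multi_member_split)
    let ?G = "add_mset (fst f, fst h) (add_mset (snd f, snd h) R)"
    let ?H = "add_mset (fst f, snd h) (add_mset (snd f, fst h) R)"
    have "e \<in># R" using less.prems(2) ne unfolding R by simp
    then have "P (graph_invariant ?G)" "P (graph_invariant ?H)"
      using less.prems(1) f h unfolding R
      by (intro less.hyps; simp add: R add_mset_commute)+
    moreover have "graph_invariant G = graph_invariant ?G - graph_invariant ?H"
      unfolding R by (simp add: bracket_def algebra_simps)
    ultimately show ?thesis by (simp only: diff)
  qed
qed

section \<open>The image under \<phi> of the kernel of \<beta>\<close>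

lemma endpoints_degree_one:
  assumes "G \<in> graphs_of_multidegree (scale_weight d (replicate n 1))"
  shows "endpoints G = repeat_mset d (mset_set {..<n})"
  using assms by (intro multiset_eqI) (auto simp: in_graphs_of_multidegree scale_weight_def)

lemma in_matchings:
  "G \<in> graphs_of_multidegree (replicate n 1) \<longleftrightarrow> \<not> has_loop G \<and> endpoints G = mset_set {..<n}"
  by (simp add: in_graphs_of_multidegree multiset_eq_iff count_mset_set')

lemma generator_hom_prod_Var:
  "generator_hom (\<Prod>G\<leftarrow>Gs. Var G) = monom (graph_invariant (sum_list Gs)) (length Gs)"
proof -
  have "(\<Prod>G\<leftarrow>Gs. monom (graph_invariant G) 1) = monom (graph_invariant (sum_list Gs)) (length Gs)"
    by (induction Gs) (simp_all add: mult_monom graph_invariant_add)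
  then show ?thesis by (simp add: generator_hom_def poly_hom_prod_list)
qed

lemma identify_vertices_eq: "identify_vertices w = identify (clump_index w)"
  by (simp add: fun_eq_iff identify_vertices_def identify_def)

text \<open>This is membership of \<open>f\<close>, placed in degree \<open>d\<close>, in the image
  under \<phi> of ker \<beta>. It is closed under differences, as \<open>bipartite_reduction\<close>
  requires of its predicate.\<close>

definition from_kernel :: "nat list \<Rightarrow> nat \<Rightarrow> nat \<Rightarrow> coord int_mpoly \<Rightarrow> bool" where
  "from_kernel w n d f \<longleftrightarrow> (\<exists>r \<in> poly_ring_on (graphs_of_multidegree (replicate n 1)).
     identify_hom w r = 0 \<and> generator_hom r = monom f d)"

lemma from_kernel_0: "from_kernel w n d 0"
  unfolding from_kernel_def by (intro bexI[of _ 0])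
    (simp_all add: identify_hom_def generator_hom_def poly_ring_on_0)

lemma from_kernel_diff:
  assumes "from_kernel w n d f" "from_kernel w n d g"
  shows "from_kernel w n d (f - g)"
proof -
  obtain r s where "r \<in> poly_ring_on (graphs_of_multidegree (replicate n 1))"
    "identify_hom w r = 0" "generator_hom r = monom f d"
    "s \<in> poly_ring_on (graphs_of_multidegree (replicate n 1))"
    "identify_hom w s = 0" "generator_hom s = monom g d"
    using assms unfolding from_kernel_def by blast
  then show ?thesis
    unfolding from_kernel_def identify_hom_def generator_hom_def
    by (intro bexI[of _ "r - s"]) (simp_all add: poly_hom_diff poly_ring_on_diff diff_monom)
qed

lemma from_kernel_add: "from_kernel w n d f \<Longrightarrow> from_kernel w n d g \<Longrightarrow> from_kernel w n d (f + g)"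
  using from_kernel_diff[OF _ from_kernel_diff[OF from_kernel_0], of w n d f g] by simp

lemma from_kernel_of_int_mult:
  assumes "from_kernel w n d f"
  shows "from_kernel w n d (of_int c * f)"
proof -
  obtain r where r: "r \<in> poly_ring_on (graphs_of_multidegree (replicate n 1))"
     "identify_hom w r = 0" "generator_hom r = monom f d" using assms unfolding from_kernel_def by blast
  have "generator_hom (of_int c * r) = monom (of_int c * f) d"
    using r(3) unfolding generator_hom_def by (simp add: poly_hom_mult poly_hom_of_int of_int_poly smult_monom)
  then show ?thesis
    using r unfolding from_kernel_def identify_hom_def
    by (intro bexI[of _ "of_int c * r"]) (simp_all add: poly_hom_mult poly_ring_on_mult poly_ring_on_of_int)
qed

lemma loop_from_kernel:
  assumes "even n" "endpoints G = repeat_mset d (mset_set {..<n})"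
    and "has_loop (identify (clump_index w) G)"
  shows "from_kernel w n d (graph_invariant G)"
proof (cases "has_loop G")
  case True
  then show ?thesis by (simp add: graph_invariant_loop from_kernel_0)
next
  case False
  obtain e where e: "e \<in># G" "clump_index w (fst e) = clump_index w (snd e)"
    using assms(3) by (auto simp: has_loop_identify)
  then have "fst e \<noteq> snd e" using False by (auto simp: has_loop_def)
  have lt: "fst e < n" "snd e < n" using edge_in_support[OF _ assms(2) e(1)] by simp_all
  obtain m where n: "n = 2 * m" using assms(1) by blast
  \<comment> \<open>The colour class \<open>B\<close> will have size \<open>m\<close>, half of the
    vertices, and consist of \<open>fst e\<close> together with \<open>m - 1\<close> vertices other
    than the ends of \<open>e\<close>.\<close>
  have "m - 1 \<le> card ({..<n} - {fst e, snd e})"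
    using lt \<open>fst e \<noteq> snd e\<close> by (simp add: card_Diff_subset n)
  then obtain C where C: "C \<subseteq> {..<n} - {fst e, snd e}" "card C = m - 1" "finite C"
    by (metis obtain_subset_with_card_n)
  define B where "B = insert (fst e) C"
  have B: "B \<subseteq> {..<n}" "fst e \<in> B" "snd e \<notin> B" "card B = m"
    using C lt \<open>fst e \<noteq> snd e\<close> n by (auto simp: B_def card_insert_if)
  have cards: "card {x \<in> {..<n}. x \<in> B} = m" "card {x \<in> {..<n}. x \<notin> B} = m"
  proof -
    have "{x \<in> {..<n}. x \<in> B} = B" "{x \<in> {..<n}. x \<notin> B} = {..<n} - B" using B(1) by auto
    then show "card {x \<in> {..<n}. x \<in> B} = m" "card {x \<in> {..<n}. x \<notin> B} = m"
      using B n by (simp_all add: card_Diff_subset finite_subset[OF B(1)])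
  qed
  show ?thesis
  proof (rule bipartite_reduction[OF assms(2) e(1), of B "from_kernel w n d"])
    show "(fst e \<in> B) \<noteq> (snd e \<in> B)" using B by simp
    show "size (filter_mset (\<lambda>v. v \<in> B) (repeat_mset d (mset_set {..<n})))
        = size (filter_mset (\<lambda>v. v \<notin> B) (repeat_mset d (mset_set {..<n})))"
      by (simp only: size_filter_repeat_mset_set finite_lessThan cards)
    show "from_kernel w n d f \<Longrightarrow> from_kernel w n d g \<Longrightarrow> from_kernel w n d (f - g)" for f g
      by (rule from_kernel_diff)
    fix H assume H: "endpoints H = repeat_mset d (mset_set {..<n})" "e \<in># H" "bipartite B H"
    have "card {..<n} = 2 * card ({..<n} \<inter> B)"
      using B n by (simp add: Int_absorb1)
    then obtain Ms where Ms: "length Ms = d" "sum_list Ms = H" "\<And>M. M \<in> set Ms \<Longrightarrow> endpoints M = mset_set {..<n}"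
      using decompose_into_matchings[OF _ H(3) H(1)] by auto
    have mem: "f \<in># sum_list Ms \<longleftrightarrow> (\<exists>M \<in> set Ms. f \<in># M)" for f by (induction Ms) auto
    have "M \<in> graphs_of_multidegree (replicate n 1)" if "M \<in> set Ms" for M
    proof -
      have "\<not> has_loop M"
        using H(3) mem that unfolding bipartite_def has_loop_def Ms(2)[symmetric] by fastforce
      then show ?thesis using Ms(3)[OF that] unfolding in_matchings by blast
    qed
    then have "(\<Prod>G\<leftarrow>Ms. Var G) \<in> poly_ring_on (graphs_of_multidegree (replicate n 1))"
      by (intro poly_ring_on_prod_list poly_ring_on_Var)
    moreover have "identify_hom w (\<Prod>G\<leftarrow>Ms. Var G) = 0"
    proof -
      \<comment> \<open>The edge \<open>e\<close> survived the reduction to a bipartite graph, so it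
        lies in one of the matchings. \<beta> kills the variable of that matching and hence the
        whole product.\<close>
      obtain M where M: "M \<in> set Ms" "e \<in># M" using H(2) mem Ms(2) by auto
      then have "has_loop (identify_vertices w M)"
        using e(2) by (auto simp: identify_vertices_eq has_loop_identify)
      moreover obtain Ks Ls where "Ms = Ks @ M # Ls" using M(1) by (meson split_list)
      ultimately show ?thesis by (simp add: identify_hom_def poly_hom_mult)
    qed
    ultimately show "from_kernel w n d (graph_invariant H)"
      unfolding from_kernel_def using Ms(1,2) generator_hom_prod_Var[of Ms] by auto
  qed
qed

lemma loop_span_from_kernel:
  assumes "even n" "f \<in> loop_span (clump_index w) (repeat_mset d (mset_set {..<n}))"
  shows "from_kernel w n d f"
proof -
  have "loop_span (clump_index w) (repeat_mset d (mset_set {..<n})) \<subseteq> {f. from_kernel w n d f}"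
    unfolding loop_span_def using assms(1)
    by (intro int_mpoly_module.span_minimal int_mpoly_module.subspaceI)
      (auto intro: loop_from_kernel from_kernel_0 from_kernel_add from_kernel_of_int_mult)
  with assms(2) show ?thesis by blast
qed

section \<open>Surjectivity on the ideals of relations\<close>

lemma card_clump:
  assumes "i < length w"
  shows "card {j. j < sum_list w \<and> clump_index w j = i} = w ! i"
proof -
  have "{j. j < sum_list w \<and> clump_index w j = i} = clump w i"
  proof (intro set_eqI iffI)
    fix j assume "j \<in> clump w i"
    moreover have "sum_list (take (Suc i) w) \<le> sum_list w"
      using sum_list_take_mono[of "Suc i" "length w" w] assms by simp
    ultimately have "j < sum_list w" by (simp add: clump_def)
    then show "j \<in> {j. j < sum_list w \<and> clump_index w j = i}"
      using clump_ex1[of j w] clump_index[of j w] assms \<open>j \<in> clump w i\<close> by blast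
  qed (use clump_index(2) in auto)
  then show ?thesis using assms by (simp add: clump_def take_Suc_conv_app_nth)
qed

text \<open>The \<open>i\<close>th clump has \<open>w ! i\<close> elements, so multidegree
  \<open>w\<close> amounts to the endpoints being the image of all \<open>n\<close> vertices. In
  this form \<open>lift_graph\<close> applies.\<close>

lemma in_graphs_of_multidegree_clumps:
  "G \<in> graphs_of_multidegree w \<longleftrightarrow>
    \<not> has_loop G \<and> endpoints G = image_mset (clump_index w) (mset_set {..<sum_list w})"
proof -
  have "count (image_mset (clump_index w) (mset_set {..<sum_list w})) i
      = (if i < length w then w ! i else 0)" for i
  proof -
    have "count (image_mset (clump_index w) (mset_set {..<sum_list w})) i
        = card {j. j < sum_list w \<and> clump_index w j = i}"
      by (simp add: count_image_mset' count_conv_size_mset filter_mset_image_mset Collect_conj_eq lessThan_def)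
    also have "\<dots> = (if i < length w then w ! i else 0)"
      using card_clump[of i w] clump_index(1)[of _ w] by auto
    finally show ?thesis .
  qed
  then show ?thesis by (simp add: in_graphs_of_multidegree multiset_eq_iff)
qed

lemma identify_matching:
  assumes "G \<in> graphs_of_multidegree (replicate (sum_list w) 1)" "\<not> has_loop (identify_vertices w G)"
  shows "identify_vertices w G \<in> graphs_of_multidegree w"
  using assms unfolding in_matchings in_graphs_of_multidegree_clumps[of _ w]
  by (simp add: identify_vertices_eq endpoints_identify)

text \<open>Commutativity of the right-hand square, degree by degree. Sending matchings that acquire
  a loop to 0 is consistent because the invariant of a graph with a loop is 0.\<close>

lemma generator_hom_identify_hom:
  "coeff (generator_hom (identify_hom w p)) d
    = poly_hom (merge (clump_index w)) (coeff (generator_hom p) d)"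
proof -
  have "poly_hom (\<lambda>G. monom (graph_invariant G) 1)
      (if has_loop (identify_vertices w G) then 0 else Var (identify_vertices w G))
      = monom (poly_hom (merge (clump_index w)) (graph_invariant G)) 1" for G
    by (simp add: poly_hom_merge identify_vertices_eq graph_invariant_loop)
  then show ?thesis
    unfolding generator_hom_def identify_hom_def poly_hom_compose
    by (simp only: poly_hom_coeff)
qed

lemma identify_hom_relation:
  assumes "p \<in> relation_ideal (replicate (sum_list w) 1)"
  shows "identify_hom w p \<in> relation_ideal w"
proof -
  have "identify_hom w p \<in> poly_ring_on (graphs_of_multidegree w)"
    unfolding identify_hom_def using assms identify_matching
    by (intro poly_hom_in_poly_ring_on[of p "graphs_of_multidegree (replicate (sum_list w) 1)"])
      (auto simp: relation_ideal_def poly_ring_on_0 poly_ring_on_Var)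
  moreover have "generator_hom (identify_hom w p) = 0"
    using assms by (intro poly_eqI) (simp add: generator_hom_identify_hom relation_ideal_def)
  ultimately show ?thesis by (simp add: relation_ideal_def)
qed

text \<open>The diagram chase: lift \<open>p\<close> to \<open>q\<close> variable by variable. Then
  \<phi> sends \<open>q\<close> into ker \<gamma>, so some \<open>s\<close> in ker \<beta> has the
  same image under \<phi>, and \<open>q - s\<close> is a relation that still maps to
  \<open>p\<close>.\<close>

lemma lift_relation:
  assumes "even (sum_list w)" "p \<in> relation_ideal w"
  shows "p \<in> identify_hom w ` relation_ideal (replicate (sum_list w) 1)"
proof -
  define n where "n = sum_list w"
  let ?R = "poly_ring_on (graphs_of_multidegree (replicate n 1))"
  have p: "p \<in> poly_ring_on (graphs_of_multidegree w)" "generator_hom p = 0"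
    using assms(2) by (simp_all add: relation_ideal_def)
  have "\<exists>H \<in> graphs_of_multidegree (replicate n 1). identify_vertices w H = G"
    if G: "G \<in> graphs_of_multidegree w" for G
  proof -
    obtain H where "identify (clump_index w) H = G" "endpoints H = mset_set {..<n}"
      using lift_graph G unfolding in_graphs_of_multidegree_clumps n_def by blast
    \<comment> \<open>A loop in \<open>H\<close> would remain a loop after identification.\<close>
    moreover have "\<not> has_loop H"
      using calculation(1) G has_loop_identify[of "clump_index w" H]
      unfolding in_graphs_of_multidegree_clumps has_loop_def[of H] by auto
    ultimately show ?thesis by (auto simp: in_matchings identify_vertices_eq simp del: One_nat_def)
  qed
  then obtain l where l: "\<And>G. G \<in> graphs_of_multidegree w \<Longrightarrow> l G \<in> graphs_of_multidegree (replicate n 1)"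
    "\<And>G. G \<in> graphs_of_multidegree w \<Longrightarrow> identify_vertices w (l G) = G" by metis
  define q where "q = poly_hom (\<lambda>G. Var (l G)) p"
  have q: "q \<in> ?R"
    unfolding q_def using p(1) l(1) by (intro poly_hom_in_poly_ring_on poly_ring_on_Var)
  have "identify_hom w q = poly_hom Var p"
    unfolding q_def identify_hom_def poly_hom_compose
    using l(2) by (intro poly_hom_cong[OF p(1)]) (simp add: in_graphs_of_multidegree)
  then have id_q: "identify_hom w q = p" by (simp add: poly_hom_Var_id)
  define f where "f d = coeff (generator_hom q) d" for d
  have "from_kernel w n d (f d)" for d
  proof (intro loop_span_from_kernel merge_kernel)
    show "even n" using assms(1) by (simp add: n_def)
    show "poly_hom (merge (clump_index w)) (f d) = 0"
      using generator_hom_identify_hom[of w q d] by (simp add: f_def id_q p(2))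
    have "f d \<in> invariants_of_degree (replicate n 1) d"
      using generator_hom_in_invariant_ring[OF q] by (simp add: f_def invariant_ring_def)
    then show "f d \<in> int_span (graph_invariant ` {G. endpoints G = repeat_mset d (mset_set {..<n})})"
      using endpoints_degree_one[of _ d n] unfolding invariants_of_degree_def
      by (auto intro: subsetD[OF int_mpoly_module.span_mono, rotated])
  qed
  then obtain r where r: "\<And>d. r d \<in> ?R" "\<And>d. identify_hom w (r d) = 0"
    "\<And>d. generator_hom (r d) = monom (f d) d"
    unfolding from_kernel_def by metis
  \<comment> \<open>The corrections are found in each degree separately; only degrees up to that of
    \<open>generator_hom q\<close> matter, so the sum is finite.\<close>
  define s where "s = (\<Sum>d\<le>degree (generator_hom q). r d)"
  have "s \<in> ?R" "identify_hom w s = 0" "generator_hom s = generator_hom q"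
    using r by (simp_all add: s_def poly_ring_on_sum identify_hom_def generator_hom_def poly_hom_sum
        f_def poly_as_sum_of_monoms)
  then have "q - s \<in> relation_ideal (replicate n 1)" "identify_hom w (q - s) = p"
    using q id_q by (simp_all add: relation_ideal_def poly_ring_on_diff identify_hom_def
        generator_hom_def poly_hom_diff)
  then show ?thesis unfolding n_def by blast
qed

theorem theorem2p13:
  fixes w :: "nat list" and n :: nat
  assumes "weight_vector w"
    and "n = sum_list w"
    and "even n"
  shows "identify_hom w ` relation_ideal (replicate n 1) = relation_ideal w"
proof
  show "identify_hom w ` relation_ideal (replicate n 1) \<subseteq> relation_ideal w"
    using identify_hom_relation assms(2) by auto
  show "relation_ideal w \<subseteq> identify_hom w ` relation_ideal (replicate n 1)"
    using lift_relation assms(2,3) by auto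
qed

end
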